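(* Let $\mathcal{X}$ be a separable locally convex $\mathbb{R}$-vector space (Hausdorff) and $\mathcal{X}^{+}\subseteq\mathcal{X}$ a convex cone. Assume that for every $0$-neighborhood $\mathcal{U}$ there are $A_1,A_2\in\mathcal{X}$ and a $0$-neighborhood $\tilde{\mathcal{U}}$ with $\tilde{\mathcal{U}}\subseteq[A_1,A_2]\subseteq\mathcal{U}$. Then for every $0$-neighborhood $\mathcal{U}$ satisfying the infinite-dimensionality condition and every $U\in\mathbf{CU}_{\mathcal{U}}(\mathcal{X}^{\ast,+})$, there are a $0$-neighborhood $\tilde{\mathcal{U}}\subseteq\mathcal{U}$ and a sequence $(U_n)_{n\in\mathbb{N}}\subseteq\mathcal{D}^{+}_{0,\tilde{\mathcal{U}}}$ converging to $U$ in the weak*-Hausdorff hypertopology.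
   Context: $\mathcal{X}^{\ast}$ is the topological dual with the weak* topology. A convex cone is a set $\mathcal{X}^+$ with $\lambda A\in\mathcal{X}^+$ and $A+B\in\mathcal{X}^+$ for $\lambda>0$, $A,B\in\mathcal{X}^+$; it induces the preorder $A\preceq B$ iff $B-A\in\mathcal{X}^+$, and intervals $[A_1,A_2]=\{A:A_1\preceq A\preceq A_2\}$. $\mathcal{X}^{\ast,+}=\{\sigma\in\mathcal{X}^{\ast}:\sigma(A)\ge0\ \forall A\in\mathcal{X}^+\}$. A $0$-neighborhood $\mathcal{U}$ satisfies the infinite-dimensionality condition if there is an infinite set $\{\sigma_n\}$ of linearly independent elements of $\mathcal{X}^{\ast}$ with $\sup_{A\in\mathcal{U}}|\sigma_n(A)|<\infty$ for every $n$. $\mathcal{U}^{\circ}=\{\sigma\in\mathcal{X}^{\ast}:|\sigma(A)|\le1\ \forall A\in\mathcal{U}\}$; $\mathbf{CU}_{\mathcal{U}}(\mathcal{X}^{\ast})$ is the set of nonempty convex weak*-closed subsets of $\mathcal{U}^{\circ}$; $\mathbf{CU}_{\mathcal{U}}(\mathcal{X}^{\ast,+})=\{U\in\mathbf{CU}_{\mathcal{U}}(\mathcal{X}^{\ast}):U\subseteq\mathcal{X}^{\ast,+}\}$. A point $\sigma_0$ of a convex $C\subseteq\mathcal{X}^{\ast}$ is exposed if some $A\in\mathcal{X}$ makes $\sigma\mapsto\sigma(A)$ attain its maximum on $C$ uniquely at $\sigma_0$; $\mathcal{E}_0(C)$ is the set of exposed points. $\mathcal{D}_{0,\mathcal{U}}=\{U\in\mathbf{CU}_{\mathcal{U}}(\mathcal{X}^{\ast}):U=\overline{\mathcal{E}_0(U)}\}$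 and $\mathcal{D}^{+}_{0,\mathcal{U}}=\mathcal{D}_{0,\mathcal{U}}\cap\mathbf{CU}_{\mathcal{U}}(\mathcal{X}^{\ast,+})$. The weak*-Hausdorff hypertopology is generated by the extended pseudometrics $d_H^{(A)}(F,\tilde F)=\max\{\sup_{\sigma\in F}\inf_{\tilde\sigma\in\tilde F}|(\sigma-\tilde\sigma)(A)|,\ \sup_{\tilde\sigma\in\tilde F}\inf_{\sigma\in F}|(\sigma-\tilde\sigma)(A)|\}$, $A\in\mathcal{X}$. *)

theory Defs
  imports "HOL-Analysis.Analysis"
begin

definition is_tvs :: "'a::real_vector topology \<Rightarrow> bool" where
  "is_tvs T \<longleftrightarrow> topspace T = UNIV
     \<and> continuous_map (prod_topology T T) T (\<lambda>(x, y). x + y)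
     \<and> continuous_map (prod_topology euclideanreal T) T (\<lambda>(c, x). c *\<^sub>R x)"

definition locally_convex_space :: "'a::real_vector topology \<Rightarrow> bool" where
  "locally_convex_space T \<longleftrightarrow> is_tvs T \<and>
     (\<forall>W. openin T W \<and> 0 \<in> W \<longrightarrow> (\<exists>V. openin T V \<and> convex V \<and> 0 \<in> V \<and> V \<subseteq> W))"

definition separable_top :: "'a topology \<Rightarrow> bool" where
  "separable_top T \<longleftrightarrow> (\<exists>D. countable D \<and> D \<subseteq> topspace T \<and> T closure_of D = topspace T)"

definition nbhd0 :: "'a::real_vector topology \<Rightarrow> 'a set \<Rightarrow> bool" where
  "nbhd0 T U \<longleftrightarrow> (\<exists>V. openin T V \<and> 0 \<in> V \<and> V \<subseteq> U)"

definition pos_convex_cone :: "'a::real_vector set \<Rightarrow> bool" where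
  "pos_convex_cone P \<longleftrightarrow> (\<forall>A\<in>P. \<forall>l::real. l > 0 \<longrightarrow> l *\<^sub>R A \<in> P) \<and> (\<forall>A\<in>P. \<forall>B\<in>P. A + B \<in> P)"

definition ord_interval :: "'a::real_vector set \<Rightarrow> 'a \<Rightarrow> 'a \<Rightarrow> 'a set" where
  "ord_interval P A1 A2 = {A. A - A1 \<in> P \<and> A2 - A \<in> P}"

definition cdual :: "'a::real_vector topology \<Rightarrow> ('a \<Rightarrow> real) set" where
  "cdual T = {f. linear f \<and> continuous_map T euclideanreal f}"

definition wstar :: "'a::real_vector topology \<Rightarrow> ('a \<Rightarrow> real) topology" where
  "wstar T = subtopology (powertop_real UNIV) (cdual T)"

definition dual_pos :: "'a::real_vector topology \<Rightarrow> 'a set \<Rightarrow> ('a \<Rightarrow> real) set" where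
  "dual_pos T P = {s \<in> cdual T. \<forall>A\<in>P. s A \<ge> 0}"

text \<open>Linear independence of a set of functionals (written out, since functions
  into real carry no real_vector instance).\<close>
definition fun_lin_indep :: "('a \<Rightarrow> real) set \<Rightarrow> bool" where
  "fun_lin_indep S \<longleftrightarrow> (\<forall>F c. finite F \<and> F \<subseteq> S \<and> (\<forall>A. (\<Sum>s\<in>F. c s * s A) = 0)
       \<longrightarrow> (\<forall>s\<in>F. c s = 0))"

definition infdim_cond :: "'a::real_vector topology \<Rightarrow> 'a set \<Rightarrow> bool" where
  "infdim_cond T U \<longleftrightarrow> (\<exists>S. S \<subseteq> cdual T \<and> infinite S \<and> fun_lin_indep S \<and>
       (\<forall>s\<in>S. \<exists>M. \<forall>A\<in>U. \<bar>s A\<bar> \<le> M))"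

definition polar :: "'a::real_vector topology \<Rightarrow> 'a set \<Rightarrow> ('a \<Rightarrow> real) set" where
  "polar T U = {s \<in> cdual T. \<forall>A\<in>U. \<bar>s A\<bar> \<le> 1}"

definition fconvex :: "('a \<Rightarrow> real) set \<Rightarrow> bool" where
  "fconvex C \<longleftrightarrow> (\<forall>s\<in>C. \<forall>t\<in>C. \<forall>u::real. 0 \<le> u \<and> u \<le> 1 \<longrightarrow> (\<lambda>A. u * s A + (1 - u) * t A) \<in> C)"

definition CU :: "'a::real_vector topology \<Rightarrow> 'a set \<Rightarrow> ('a \<Rightarrow> real) set set" where
  "CU T U = {C. C \<noteq> {} \<and> fconvex C \<and> closedin (wstar T) C \<and> C \<subseteq> polar T U}"

definition CU_pos :: "'a::real_vector topology \<Rightarrow> 'a set \<Rightarrow> 'a set \<Rightarrow> ('a \<Rightarrow> real) set set" where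
  "CU_pos T P U = {C \<in> CU T U. C \<subseteq> dual_pos T P}"

definition exposed_points :: "('a \<Rightarrow> real) set \<Rightarrow> ('a \<Rightarrow> real) set" where
  "exposed_points C = {s0 \<in> C. \<exists>A. \<forall>s\<in>C. s \<noteq> s0 \<longrightarrow> s A < s0 A}"

definition D0 :: "'a::real_vector topology \<Rightarrow> 'a set \<Rightarrow> ('a \<Rightarrow> real) set set" where
  "D0 T U = {C \<in> CU T U. C = (wstar T) closure_of (exposed_points C)}"

definition D0_pos :: "'a::real_vector topology \<Rightarrow> 'a set \<Rightarrow> 'a set \<Rightarrow> ('a \<Rightarrow> real) set set" where
  "D0_pos T P U = D0 T U \<inter> CU_pos T P U"

definition dH :: "'a \<Rightarrow> ('a \<Rightarrow> real) set \<Rightarrow> ('a \<Rightarrow> real) set \<Rightarrow> ereal" where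
  "dH A F G = max (SUP s\<in>F. INF t\<in>G. ereal \<bar>s A - t A\<bar>) (SUP t\<in>G. INF s\<in>F. ereal \<bar>s A - t A\<bar>)"

text \<open>Convergence in the weak*-Hausdorff hypertopology (generated by the family dH A):
  convergence with respect to every generating pseudometric.\<close>
definition wH_converges :: "(nat \<Rightarrow> ('a \<Rightarrow> real) set) \<Rightarrow> ('a \<Rightarrow> real) set \<Rightarrow> bool" where
  "wH_converges Us U \<longleftrightarrow> (\<forall>A. (\<lambda>n. dH A (Us n) U) \<longlonglongrightarrow> 0)"

end

theory Submission
  imports Defs
begin

text \<open>
  The interval hypothesis provides an interior point e of the cone, so a positive functional is controlled by
  its value at e, and the Hahn-Banach theorem for the gauge of e yields positive functionals separating points.
  Round C to a finite set of its points c_0, ..., c_(m-1) and choose positive functionals tau_i, with tau_i close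
  to c_i for i < m and tau_i rapidly decreasing for i at least m, such that any finitely many of them admit a
  dual basis in X. The approximant is the image under z \<mapsto> sum_i z_i tau_i of the set of all z \<ge> 0
  with sum_(i<m) z_i = 1 and sum_i z_i^2 \<le> 2. It consists of positive functionals for trivial reasons. A
  finitely supported z with sum_i z_i^2 = 2 maximises the functional z uniquely; this functional is approximated
  in l^2 by elements of X, and by strong convexity their maximisers are exposed and close to z. Such z are weakly
  dense: cut an arbitrary z off at a large index N and put the missing mass on coordinate N, where tau_N is tiny.
\<close>

section \<open>The Hahn-Banach theorem and common kernels\<close>

text \<open>Positivity is the obstacle. Correcting a new functional by earlier ones, so that it
  vanishes at dual vectors already chosen, may leave the positive cone; scaling it down never does.
  Hence \<open>B N\<close> is exactly dual only to the first \<open>N\<close> functionals, the later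
  ones being merely small on it, and prescribed coefficients are realised by elements of the space
  up to an error that tends to 0 with \<open>N\<close>. This is why a quadratic constraint is
  wanted: its strong convexity turns almost maximal into close. The infinite-dimensionality
  condition says that finitely many functionals always have a common zero other than 0, which leaves
  a direction for a further independent positive functional. Separability reduces C to finite sets:
  the polar of a neighborhood is equicontinuous, so closeness at finitely many terms of a dense
  sequence suffices in the limit. The approximants need not lie in the polar of the given
  neighborhood, which is why it has to shrink.\<close>

definition sublinear :: "('a::real_vector \<Rightarrow> real) \<Rightarrow> bool" where
  "sublinear p \<longleftrightarrow> (\<forall>x y. p (x + y) \<le> p x + p y) \<and> (\<forall>c x. 0 \<le> c \<longrightarrow> p (c *\<^sub>R x) = c * p x)"

lemma sublinear_add: "sublinear p \<Longrightarrow> p (x + y) \<le> p x + p y"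
  and sublinear_scale: "sublinear p \<Longrightarrow> 0 \<le> c \<Longrightarrow> p (c *\<^sub>R x) = c * p x"
  by (auto simp: sublinear_def)

lemma sublinear_zero: "sublinear p \<Longrightarrow> p 0 = 0"
  using sublinear_scale[of p 0 0] by simp

lemma sublinear_minus_le: "sublinear p \<Longrightarrow> - p (- x) \<le> p x"
  using sublinear_add[of p x "- x"] sublinear_zero[of p] by simp

lemma sublinearI:
  assumes "\<And>x y. p (x + y) \<le> p x + p y" and "p 0 = 0"
    and le: "\<And>c x. 0 < c \<Longrightarrow> p (c *\<^sub>R x) \<le> c * p x"
  shows "sublinear p"
proof -
  have "c * p x \<le> p (c *\<^sub>R x)" if "0 < c" for c x
    using le[of "inverse c" "c *\<^sub>R x"] that by (simp add: field_simps)
  then have "p (c *\<^sub>R x) = c * p x" if "0 \<le> c" for c x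
    using that assms(2) le[of c x] by (cases "c = 0") (auto intro: antisym)
  then show ?thesis using assms(1) by (simp add: sublinear_def)
qed

lemma Inf_le_add:
  fixes X Y Z :: "real set"
  assumes "X \<noteq> {}" "Y \<noteq> {}" "bdd_below Z"
    and le: "\<And>x y. x \<in> X \<Longrightarrow> y \<in> Y \<Longrightarrow> \<exists>z\<in>Z. z \<le> x + y"
  shows "Inf Z \<le> Inf X + Inf Y"
proof -
  have xy: "Inf Z \<le> x + y" if "x \<in> X" "y \<in> Y" for x y
    using le[OF that] assms(3) by (meson cInf_lower dual_order.trans)
  have "Inf Z - y \<le> Inf X" if "y \<in> Y" for y
    using xy that assms(1) by (intro cInf_greatest) (auto simp: algebra_simps)
  then have "Inf Z - Inf X \<le> Inf Y"
    using assms(2) by (intro cInf_greatest) (force simp: algebra_simps)+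
  then show ?thesis by simp
qed

lemma Inf_le_scale:
  fixes X Z :: "real set"
  assumes "X \<noteq> {}" "0 < c" "bdd_below Z" and le: "\<And>x. x \<in> X \<Longrightarrow> \<exists>z\<in>Z. z \<le> c * x"
  shows "Inf Z \<le> c * Inf X"
proof -
  have "Inf Z / c \<le> Inf X"
  proof (rule cInf_greatest[OF assms(1)])
    fix x assume "x \<in> X"
    then have "Inf Z \<le> c * x"
      using le assms(3) by (meson cInf_lower dual_order.trans)
    then show "Inf Z / c \<le> x" using assms(2) by (simp add: field_simps)
  qed
  then show ?thesis using assms(2) by (simp add: field_simps)
qed

text \<open>The minorant is the infimum over t \<ge> 0 of
  \<open>q (x + t *\<^sub>R a) - t * q a\<close>; t = 0 gives the bound by \<open>q\<close>, t = 1
  the value at \<open>- a\<close>. That value is as low as \<open>q a\<close> permits, so a minimal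
  sublinear functional must already be odd.\<close>

lemma sublinear_directional:
  fixes q :: "'a::real_vector \<Rightarrow> real"
  assumes q: "sublinear q"
  obtains q' where "sublinear q'" "\<And>x. q' x \<le> q x" "q' (- a) \<le> - q a"
proof
  define F where "F x t = q (x + t *\<^sub>R a) - t * q a" for x t
  define q' where "q' x = Inf (F x ` {0..})" for x
  have lb: "- q (- x) \<le> F x t" if "0 \<le> t" for x t
  proof -
    have "t * q a = q ((x + t *\<^sub>R a) + (- x))" using sublinear_scale[OF q that, of a] by simp
    also have "\<dots> \<le> q (x + t *\<^sub>R a) + q (- x)" by (rule sublinear_add[OF q])
    finally show ?thesis by (simp add: F_def)
  qed
  then have bdd: "bdd_below (F x ` {0..})" for x by (intro bdd_belowI2[of _ "- q (- x)"]) auto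
  have le: "q' x \<le> F x t" if "0 \<le> t" for x t
    unfolding q'_def using bdd that by (simp add: cINF_lower)
  show "q' x \<le> q x" for x using le[of 0 x] by (simp add: F_def)
  show "q' (- a) \<le> - q a" using le[of 1 "- a"] sublinear_zero[OF q] by (simp add: F_def)
  show "sublinear q'"
  proof (rule sublinearI)
    show "q' (x + y) \<le> q' x + q' y" for x y
      unfolding q'_def
    proof (rule Inf_le_add[OF _ _ bdd])
      fix u v assume "u \<in> F x ` {0..}" "v \<in> F y ` {0..}"
      then obtain s t where st: "0 \<le> s" "0 \<le> t" "u = F x s" "v = F y t" by auto
      have "F (x + y) (s + t) \<le> F x s + F y t"
        using sublinear_add[OF q, of "x + s *\<^sub>R a" "y + t *\<^sub>R a"] by (simp add: F_def algebra_simps)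
      then show "\<exists>z\<in>F (x + y) ` {0..}. z \<le> u + v"
        using st by (intro bexI[of _ "F (x + y) (s + t)"]) auto
    qed auto
    have "0 \<le> q' 0" unfolding q'_def using lb[of _ 0] sublinear_zero[OF q]
      by (intro cINF_greatest) auto
    moreover have "q' 0 \<le> 0" using le[of 0 0] sublinear_zero[OF q] by (simp add: F_def)
    ultimately show "q' 0 = 0" by simp
    fix c :: real and x assume c: "0 < c"
    show "q' (c *\<^sub>R x) \<le> c * q' x"
      unfolding q'_def
    proof (rule Inf_le_scale[OF _ c bdd])
      fix u assume "u \<in> F x ` {0..}"
      then obtain t where t: "0 \<le> t" "u = F x t" by auto
      have "F (c *\<^sub>R x) (c * t) = c * u"
        unfolding t(2) using sublinear_scale[OF q, of c "x + t *\<^sub>R a"] c by (simp add: F_def algebra_simps)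
      then show "\<exists>z\<in>F (c *\<^sub>R x) ` {0..}. z \<le> c * u"
        using c t by (intro bexI[of _ "F (c *\<^sub>R x) (c * t)"] imageI) auto
    qed simp
  qed
qed

text \<open>The common upper bound \<open>p\<close> keeps the pointwise infimum finite, through
  \<open>- p (- x)\<close>. Subadditivity uses the chain: of two members, the smaller one works for
  both summands.\<close>

lemma sublinear_Inf_chain:
  fixes Q :: "('a::real_vector \<Rightarrow> real) set"
  assumes ne: "Q \<noteq> {}" and sub: "\<And>q. q \<in> Q \<Longrightarrow> sublinear q"
    and le: "\<And>q x. q \<in> Q \<Longrightarrow> q x \<le> p x"
    and chain: "\<And>q r. q \<in> Q \<Longrightarrow> r \<in> Q \<Longrightarrow> q \<le> r \<or> r \<le> q"
  obtains u where "sublinear u" "\<And>q x. q \<in> Q \<Longrightarrow> u x \<le> q x"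
proof
  define u where "u x = Inf ((\<lambda>q. q x) ` Q)" for x
  have bdd: "bdd_below ((\<lambda>q. q x) ` Q)" for x
  proof (rule bdd_belowI2)
    fix q assume "q \<in> Q"
    then show "- p (- x) \<le> q x" using sublinear_minus_le[OF sub, of q x] le[of q "- x"] by simp
  qed
  show "u x \<le> q x" if "q \<in> Q" for q x unfolding u_def using bdd that by (rule cINF_lower)
  show "sublinear u"
  proof (rule sublinearI)
    show "u (x + y) \<le> u x + u y" for x y
      unfolding u_def
    proof (rule Inf_le_add[OF _ _ bdd])
      fix v w assume "v \<in> (\<lambda>q. q x) ` Q" "w \<in> (\<lambda>q. q y) ` Q"
      then obtain q r where qr: "q \<in> Q" "r \<in> Q" "v = q x" "w = r y" by auto
      show "\<exists>z\<in>(\<lambda>q. q (x + y)) ` Q. z \<le> v + w"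
        using chain[OF qr(1,2)]
      proof
        assume "q \<le> r"
        then have "q (x + y) \<le> v + w"
          using sublinear_add[OF sub[OF qr(1)], of x y] le_funD[of q r y] qr by simp
        then show ?thesis using qr by blast
      next
        assume "r \<le> q"
        then have "r (x + y) \<le> v + w"
          using sublinear_add[OF sub[OF qr(2)], of x y] le_funD[of r q x] qr by simp
        then show ?thesis using qr by blast
      qed
    qed (use ne in auto)
    have "(\<lambda>q. q 0) ` Q = {0}" using ne sub sublinear_zero by force
    then show "u 0 = 0" unfolding u_def by simp
    show "u (c *\<^sub>R x) \<le> c * u x" if "0 < c" for c x
      unfolding u_def using that ne
      by (intro Inf_le_scale[OF _ _ bdd]) (auto simp: sublinear_scale[OF sub])
  qed
qed

lemma Hahn_Banach_sublinear:
  fixes p :: "'a::real_vector \<Rightarrow> real"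
  assumes p: "sublinear p"
  obtains f where "linear f" "\<And>x. f x \<le> p x" "f a = p a"
proof -
  \<comment> \<open>Minimising below \<open>p'\<close> instead of \<open>p\<close> secures the value
    at \<open>a\<close>: the bound \<open>f (- a) \<le> - p a\<close> becomes
    \<open>p a \<le> f a\<close> once \<open>f\<close> is odd.\<close>
  obtain p' where p': "sublinear p'" "\<And>x. p' x \<le> p x" "p' (- a) \<le> - p a"
    using sublinear_directional[OF p] by blast
  define \<A> where "\<A> = {q. sublinear q \<and> q \<le> p'}"
  have "\<exists>m\<in>\<A>. \<forall>q\<in>\<A>. m \<ge> q \<longrightarrow> q = m"
  proof (rule predicate_Zorn)
    show "partial_order_on \<A> (relation_of (\<ge>) \<A>)"
      by (rule partial_order_on_relation_ofI) auto
    fix Q assume Q: "Q \<in> Chains (relation_of (\<ge>) \<A>)"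
    then have QA: "Q \<subseteq> \<A>" by (rule Chains_relation_of)
    show "\<exists>u\<in>\<A>. \<forall>q\<in>Q. q \<ge> u"
    proof (cases "Q = {}")
      case True
      then show ?thesis using p'(1) by (auto simp: \<A>_def)
    next
      case False
      obtain u where u: "sublinear u" "\<And>q x. q \<in> Q \<Longrightarrow> u x \<le> q x"
      proof (rule sublinear_Inf_chain[OF False, of p'])
        show "q \<le> r \<or> r \<le> q" if "q \<in> Q" "r \<in> Q" for q r
          using Q that unfolding Chains_def relation_of_def by blast
      qed (use QA in \<open>auto simp: \<A>_def le_fun_def\<close>)
      obtain q where q: "q \<in> Q" using False by blast
      then have "u \<le> p'" using u(2)[OF q] QA by (auto simp: \<A>_def le_fun_def intro: order_trans)
      then show ?thesis using u by (intro bexI[of _ u]) (auto simp: \<A>_def le_fun_def)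
    qed
  qed
  then obtain f where f: "sublinear f" "f \<le> p'" 
    and min: "\<And>q. sublinear q \<Longrightarrow> q \<le> p' \<Longrightarrow> q \<le> f \<Longrightarrow> q = f"
    by (auto simp: \<A>_def)
  have neg: "f (- x) = - f x" for x
  proof -
    obtain q where q: "sublinear q" "\<And>y. q y \<le> f y" "q (- x) \<le> - f x"
      using sublinear_directional[OF f(1)] by blast
    have "q \<le> f" using q(2) by (simp add: le_fun_def)
    then have "q = f" using min q(1) f(2) order_trans by blast
    then show ?thesis using q(3) sublinear_minus_le[OF f(1), of x] by simp
  qed
  have "linear f"
  proof (rule linearI)
    fix x y
    show "f (x + y) = f x + f y"
      using sublinear_add[OF f(1), of x y] sublinear_add[OF f(1), of "x + y" "- y"] neg[of y] by simp
  next
    fix c x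
    show "f (c *\<^sub>R x) = c *\<^sub>R f x"
      using sublinear_scale[OF f(1), of c x] sublinear_scale[OF f(1), of "- c" x] neg[of "c *\<^sub>R x"]
      by (cases "0 \<le> c") auto
  qed
  moreover have "f x \<le> p x" for x using f(2) p'(2)[of x] by (auto simp: le_fun_def intro: order_trans)
  moreover have "f a = p a"
    using f(2) p'(3) neg[of a] \<open>\<And>x. f x \<le> p x\<close>[of a] le_funD[of f p' "- a"] by simp
  ultimately show thesis using that by blast
qed

section \<open>Linear algebra of finitely many functionals\<close>

lemma homogeneous_system_nontrivial:
  fixes M :: "'i \<Rightarrow> 'j \<Rightarrow> real"
  assumes "finite I" "finite J" "card I < card J"
  shows "\<exists>c. (\<exists>j\<in>J. c j \<noteq> 0) \<and> (\<forall>i\<in>I. (\<Sum>j\<in>J. c j * M i j) = 0)"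
  using assms
proof (induction I arbitrary: J M rule: finite_induct)
  case empty
  then have "J \<noteq> {}" by auto
  then show ?case by (intro exI[of _ "\<lambda>_. 1"]) auto
next
  case (insert i I)
  show ?case
  proof (cases "\<forall>j\<in>J. M i j = 0")
    case True
    obtain c where "\<exists>j\<in>J. c j \<noteq> 0" "\<forall>i\<in>I. (\<Sum>j\<in>J. c j * M i j) = 0"
      using insert.IH[of J M] insert.prems insert.hyps by auto
    then show ?thesis using True by (intro exI[of _ c]) auto
  next
    case False
    then obtain k where k: "k \<in> J" "M i k \<noteq> 0" by blast
    \<comment> \<open>Gaussian elimination: equation \<open>i\<close> is solved for the unknown
      \<open>k\<close> and substituted into the others; \<open>d\<close> below recovers that
      unknown.\<close>
    define M' where "M' l j = M l j - M l k * M i j / M i k" for l j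
    have "card I < card (J - {k})" using insert k by auto
    then obtain c where c: "\<exists>j\<in>J - {k}. c j \<noteq> 0" "\<forall>l\<in>I. (\<Sum>j\<in>J - {k}. c j * M' l j) = 0"
      using insert.IH[of "J - {k}" M'] insert.prems by auto
    define s where "s = (\<Sum>j\<in>J - {k}. c j * M i j)"
    define d where "d = c(k := - s / M i k)"
    have sum_d: "(\<Sum>j\<in>J. d j * M l j) = - s / M i k * M l k + (\<Sum>j\<in>J - {k}. c j * M l j)" for l
      using k insert.prems by (simp add: sum.remove[of J k] d_def)
    have "(\<Sum>j\<in>J. d j * M l j) = 0" if "l \<in> insert i I" for l
    proof (cases "l = i")
      case True
      then show ?thesis using sum_d[of i] k by (simp add: s_def)
    next
      case False
      then have "(\<Sum>j\<in>J - {k}. c j * M' l j) = 0" using c(2) that by blast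
      then have "(\<Sum>j\<in>J - {k}. c j * M l j) = M l k / M i k * s"
        by (simp add: M'_def s_def sum_subtractf sum_distrib_left algebra_simps)
      then show ?thesis using sum_d[of l] by simp
    qed
    moreover have "\<exists>j\<in>J. d j \<noteq> 0" using c(1) by (auto simp: d_def)
    ultimately show ?thesis by blast
  qed
qed

text \<open>If the kernel were trivial, no n + 1 vectors would be independent, so a basis would have
  at most n elements; n + 1 functionals in \<open>S\<close> would then satisfy a linear relation on
  it, hence everywhere. Elimination is used twice, first with basis vectors as unknowns, then with
  functionals.\<close>

lemma common_kernel_nontrivial:
  fixes t :: "nat \<Rightarrow> 'a::real_vector \<Rightarrow> real" and S :: "('a \<Rightarrow> real) set"
  assumes lin: "\<And>k. k < n \<Longrightarrow> linear (t k)"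
    and S: "infinite S" "fun_lin_indep S" "\<And>s. s \<in> S \<Longrightarrow> linear s"
  shows "\<exists>A. A \<noteq> 0 \<and> (\<forall>k<n. t k A = 0)"
proof (rule ccontr)
  assume "\<not> ?thesis"
  then have inj: "A = 0" if "\<And>k. k < n \<Longrightarrow> t k A = 0" for A using that by blast
  obtain E :: "'a set" where E: "independent E" "span E = UNIV"
    using basis_exists[of "UNIV :: 'a set"] by (metis top.extremum_uniqueI)
  have card_le: "card J \<le> n" if J: "finite J" "J \<subseteq> E" for J
  proof (rule ccontr)
    assume "\<not> card J \<le> n"
    then obtain c where c: "\<exists>x\<in>J. c x \<noteq> 0" "\<forall>k<n. (\<Sum>x\<in>J. c x * t k x) = 0"
      using homogeneous_system_nontrivial[of "{..<n}" J t] J by auto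
    have "(\<Sum>x\<in>J. c x *\<^sub>R x) = 0"
    proof (rule inj)
      fix k assume "k < n"
      then show "t k (\<Sum>x\<in>J. c x *\<^sub>R x) = 0"
        using c lin[of k] by (simp add: linear_sum linear_cmul)
    qed
    then show False using c(1) E(1) J independent_explicit_module by blast
  qed
  then have "finite E" by (meson finite_if_finite_subsets_card_bdd)
  obtain F where F: "finite F" "F \<subseteq> S" "card F = Suc n" 
    using infinite_arbitrarily_large[OF S(1)] by blast
  then obtain c where c: "\<exists>s\<in>F. c s \<noteq> 0" "\<forall>x\<in>E. (\<Sum>s\<in>F. c s * s x) = 0"
    using homogeneous_system_nontrivial[of E F "\<lambda>x s. s x"] card_le[of E] \<open>finite E\<close> by auto
  have "(\<Sum>s\<in>F. c s * s A) = 0" for A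
  proof -
    have "linear (\<lambda>A. \<Sum>s\<in>F. c s * s A)"
    proof (rule linear_compose_sum, rule ballI)
      fix s assume "s \<in> F"
      then have "linear s" using F S by blast
      then show "linear (\<lambda>A. c s * s A)" using linear_compose_scale_right[of s "c s"] by simp
    qed
    moreover have "A \<in> span E" using E by simp
    ultimately show ?thesis using c(2) linear_eq_0_on_span by (metis (no_types, lifting))
  qed
  then show False using S(2) F c(1) unfolding fun_lin_indep_def by blast
qed

section \<open>Convex bodies with dense exposed points\<close>

lemma tendsto_pointwise:
  fixes f :: "'i \<Rightarrow> 'a \<Rightarrow> 'b::topological_space"
  assumes "\<And>x. ((\<lambda>n. f n x) \<longlongrightarrow> l x) F"
  shows "(f \<longlongrightarrow> l) F"
proof -
  have "limitin (product_topology (\<lambda>_. euclidean) UNIV) f l F"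
    using assms by (simp add: limitin_componentwise)
  then show ?thesis by (simp add: euclidean_product_topology)
qed

lemma compact_fun_imp_closed:
  fixes K :: "('a \<Rightarrow> real) set"
  assumes "compact K"
  shows "closed K"
proof -
  have "Hausdorff_space (powertop_real (UNIV :: 'a set))"
    by (simp add: Hausdorff_space_product_topology)
  then show ?thesis
    using compactin_imp_closedin[of euclidean K] assms by (simp add: euclidean_product_topology)
qed

text \<open>Any bound greater than 1 would do in place of 2: it must leave room for mass beyond index m.\<close>

definition simplex_slice :: "nat \<Rightarrow> (nat \<Rightarrow> real) set" where
  "simplex_slice m = {z. (\<forall>i. 0 \<le> z i) \<and> (\<Sum>i<m. z i) = 1 \<and> (\<forall>n. (\<Sum>i<n. (z i)\<^sup>2) \<le> 2)}"

lemma simplex_sliceD: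
  assumes "z \<in> simplex_slice m"
  shows "0 \<le> z i" and "(\<Sum>i<m. z i) = 1" and "(\<Sum>i<n. (z i)\<^sup>2) \<le> 2" and "z i \<le> 2"
proof -
  show "0 \<le> z i" "(\<Sum>i<m. z i) = 1" and le: "(\<Sum>i<n. (z i)\<^sup>2) \<le> 2" for n
    using assms by (auto simp: simplex_slice_def)
  have "(z i)\<^sup>2 \<le> (\<Sum>i<Suc i. (z i)\<^sup>2)" by (simp add: sum_nonneg)
  also have "\<dots> \<le> 2" by (rule le)
  also have "\<dots> \<le> 2\<^sup>2" by simp
  finally show "z i \<le> 2" by (rule power2_le_imp_le) simp
qed

text \<open>Tychonoff. The quadratic condition is imposed on all finite partial sums, so every
  condition involves finitely many coordinates and survives coordinatewise limits.\<close>

lemma compact_simplex_slice: "compact (simplex_slice m)"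
proof -
  have "closed (simplex_slice m)"
    unfolding simplex_slice_def
    by (intro closed_Collect_conj closed_Collect_all closed_Collect_le closed_Collect_eq
        continuous_intros continuous_on_product_coordinates)
  moreover have "compact (PiE UNIV (\<lambda>_::nat. {0..2::real}))"
    using compactin_PiE[of "\<lambda>_. euclideanreal" UNIV "\<lambda>_::nat. {0..2::real}"]
    by (simp add: euclidean_product_topology)
  moreover have "simplex_slice m \<subseteq> PiE UNIV (\<lambda>_::nat. {0..2::real})"
    by (auto simp: simplex_sliceD)
  ultimately show ?thesis
    by (metis closed_Int_compact inf.absorb1)
qed

lemma unit_mem_simplex_slice:
  assumes "j < m"
  shows "(\<lambda>i. if i = j then 1 else 0) \<in> simplex_slice m"
  using assms by (auto simp: simplex_slice_def if_distrib[of "\<lambda>x. x\<^sup>2"] cong: if_cong)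

text \<open>Parallelogram law. The last term is the room that the midpoint of two distinct points
  leaves in the quadratic constraint.\<close>

lemma sum_midpoint_square:
  fixes z w :: "'i \<Rightarrow> real"
  shows "(\<Sum>i\<in>I. ((z i + w i) / 2)\<^sup>2)
    = (\<Sum>i\<in>I. (z i)\<^sup>2) / 2 + (\<Sum>i\<in>I. (w i)\<^sup>2) / 2 - (\<Sum>i\<in>I. (z i - w i)\<^sup>2) / 4"
  unfolding sum_divide_distrib sum.distrib[symmetric] sum_subtractf[symmetric]
  by (rule sum.cong) (auto simp: power2_eq_square field_simps)

lemma convex_comb_mem_simplex_slice:
  assumes z: "z \<in> simplex_slice m" and w: "w \<in> simplex_slice m" and u: "0 \<le> u" "u \<le> 1"
  shows "(\<lambda>i. u * z i + (1 - u) * w i) \<in> simplex_slice m"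
proof -
  have sq: "(u * a + (1 - u) * b)\<^sup>2 \<le> u * a\<^sup>2 + (1 - u) * b\<^sup>2" for a b :: real
  proof -
    have "u * a\<^sup>2 + (1 - u) * b\<^sup>2 - (u * a + (1 - u) * b)\<^sup>2 = u * (1 - u) * (a - b)\<^sup>2"
      by (simp add: power2_eq_square algebra_simps)
    moreover have "0 \<le> u * (1 - u) * (a - b)\<^sup>2" using u by simp
    ultimately show ?thesis by linarith
  qed
  have "(\<Sum>i<n. (u * z i + (1 - u) * w i)\<^sup>2) \<le> 2" for n
  proof -
    have "(\<Sum>i<n. (u * z i + (1 - u) * w i)\<^sup>2) \<le> (\<Sum>i<n. u * (z i)\<^sup>2 + (1 - u) * (w i)\<^sup>2)"
      by (intro sum_mono sq)
    also have "\<dots> = u * (\<Sum>i<n. (z i)\<^sup>2) + (1 - u) * (\<Sum>i<n. (w i)\<^sup>2)"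
      by (simp add: sum.distrib sum_distrib_left)
    also have "\<dots> \<le> u * 2 + (1 - u) * 2"
      using u simplex_sliceD(3)[OF z] simplex_sliceD(3)[OF w] by (intro add_mono mult_left_mono) auto
    finally show ?thesis by simp
  qed
  moreover have "(\<Sum>i<m. u * z i + (1 - u) * w i) = 1"
    using simplex_sliceD(2)[OF z] simplex_sliceD(2)[OF w]
    by (simp add: sum.distrib sum_distrib_left[symmetric])
  ultimately show ?thesis
    using u simplex_sliceD(1)[OF z] simplex_sliceD(1)[OF w] by (auto simp: simplex_slice_def)
qed

text \<open>Moving from the midpoint of two distinct points along any coordinate beyond m stays in the slice,
  since the midpoint has room in the quadratic constraint.\<close>

lemma midpoint_plus_mem_simplex_slice:
  assumes z: "z \<in> simplex_slice m" and w: "w \<in> simplex_slice m" and ne: "z \<noteq> w" and k: "m \<le> k"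
  obtains t where "0 < t" "(\<lambda>i. (z i + w i) / 2 + (if i = k then t else 0)) \<in> simplex_slice m"
proof -
  obtain l where l: "z l \<noteq> w l" using ne by blast
  define d where "d = (z l - w l)\<^sup>2"
  have d: "0 < d" using l by (simp add: d_def)
  \<comment> \<open>The midpoint leaves room \<open>d / 4\<close>. Raising coordinate
    \<open>k\<close> by \<open>t\<close> costs \<open>2 * t * v k + t\<^sup>2\<close>, which is at
    most \<open>5 * t\<close> because \<open>v k \<le> 2\<close> and
    \<open>t \<le> 1\<close>.\<close>
  define t where "t = min 1 (d / 20)"
  have t: "0 < t" "t \<le> 1" "t \<le> d / 20" using d by (auto simp: t_def)
  define v where "v i = (z i + w i) / 2" for i
  have v: "0 \<le> v i" "v i \<le> 2" for i
    using simplex_sliceD(1,4)[OF z, of i] simplex_sliceD(1,4)[OF w, of i] by (auto simp: v_def)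
  have big: "(\<Sum>i<n. (v i + (if i = k then t else 0))\<^sup>2) \<le> 2" if n: "l < n" for n
  proof -
    have "d \<le> (\<Sum>i<n. (z i - w i)\<^sup>2)"
      unfolding d_def using n by (intro member_le_sum) auto
    then have "(\<Sum>i<n. (v i)\<^sup>2) \<le> 2 - d / 4"
      using sum_midpoint_square[of z w "{..<n}"] simplex_sliceD(3)[OF z, of n] simplex_sliceD(3)[OF w, of n]
      by (simp add: v_def)
    moreover have "(\<Sum>i<n. (v i + (if i = k then t else 0))\<^sup>2)
        = (\<Sum>i<n. (v i)\<^sup>2 + (if i = k then 2 * t * v i + t\<^sup>2 else 0))"
      by (rule sum.cong) (auto simp: power2_eq_square algebra_simps)
    moreover have "\<dots> \<le> (\<Sum>i<n. (v i)\<^sup>2) + (2 * t * v k + t\<^sup>2)"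
      using t v by (auto simp: sum.distrib)
    moreover have "2 * t * v k + t\<^sup>2 \<le> 5 * t"
    proof -
      have "2 * t * v k \<le> 2 * t * 2" using t v by (intro mult_left_mono) auto
      moreover have "t\<^sup>2 \<le> t" using t by (simp add: power2_eq_square)
      ultimately show ?thesis by simp
    qed
    ultimately show ?thesis using t by simp
  qed
  have "(\<Sum>i<n. (v i + (if i = k then t else 0))\<^sup>2) \<le> 2" for n
  proof -
    have "(\<Sum>i<n. (v i + (if i = k then t else 0))\<^sup>2)
        \<le> (\<Sum>i<max n (Suc l). (v i + (if i = k then t else 0))\<^sup>2)"
      by (intro sum_mono2) auto
    also have "\<dots> \<le> 2" by (rule big) simp
    finally show ?thesis .
  qed
  moreover have "(\<Sum>i<m. v i + (if i = k then t else 0)) = 1"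
    using k simplex_sliceD(2)[OF z] simplex_sliceD(2)[OF w]
    by (simp add: sum.distrib v_def sum_divide_distrib[symmetric])
  ultimately have "(\<lambda>i. v i + (if i = k then t else 0)) \<in> simplex_slice m"
    using v t by (auto simp: simplex_slice_def)
  then show thesis using that[OF t(1)] by (simp add: v_def)
qed

text \<open>The first m coordinates lie between 0 and 1 and sum to 1, so their squares sum to at
  most 1 and cannot reach 2. The coordinate found beyond m is the one along which maximisers are
  perturbed.\<close>

lemma full_point_has_tail:
  assumes z: "z \<in> simplex_slice m" and N: "m \<le> N" and full: "(\<Sum>i<N. (z i)\<^sup>2) = 2"
  obtains k where "m \<le> k" "k < N" "0 < z k"
proof -
  have le1: "z i \<le> 1" if "i < m" for i
  proof -
    have "z i \<le> (\<Sum>i<m. z i)" using that simplex_sliceD(1)[OF z] by (intro member_le_sum) auto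
    then show ?thesis using simplex_sliceD(2)[OF z] by simp
  qed
  have "(\<Sum>i<m. (z i)\<^sup>2) \<le> (\<Sum>i<m. z i)"
    using le1 simplex_sliceD(1)[OF z] by (intro sum_mono) (auto simp: power2_eq_square mult_left_le)
  then have "(\<Sum>i<m. (z i)\<^sup>2) \<noteq> (\<Sum>i<N. (z i)\<^sup>2)" using full simplex_sliceD(2)[OF z] by simp
  then have "\<exists>k\<in>{..<N} - {..<m}. (z k)\<^sup>2 \<noteq> 0"
    using N sum.mono_neutral_left[of "{..<N}" "{..<m}" "\<lambda>i. (z i)\<^sup>2"] by auto
  then obtain k where "m \<le> k" "k < N" "z k \<noteq> 0" by auto
  then show thesis using that[of k] simplex_sliceD(1)[OF z, of k] by linarith
qed

text \<open>\<open>B N\<close> is chosen anew for every N, so that its error on the remaining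
  functionals, bounded in \<open>tail\<close>, vanishes as N grows. Only N \<ge> m is asked: the
  first m functionals are meant to stay close to prescribed ones and cannot be scaled down.\<close>

locale rapidly_decreasing_family =
  fixes \<tau> :: "nat \<Rightarrow> 'a::real_vector \<Rightarrow> real" and m :: nat and B :: "nat \<Rightarrow> nat \<Rightarrow> 'a"
  assumes lin: "\<And>i. linear (\<tau> i)"
    and summ: "\<And>A. summable (\<lambda>i. \<bar>\<tau> i A\<bar>)"
    and m_pos: "0 < m"
    and dual: "\<And>N i j. m \<le> N \<Longrightarrow> j < N \<Longrightarrow> i < N \<Longrightarrow> \<tau> i (B N j) = (if i = j then 1 else 0)"
    and tail: "\<And>N i j. m \<le> N \<Longrightarrow> j < N \<Longrightarrow> N \<le> i \<Longrightarrow> \<bar>\<tau> i (B N j)\<bar> \<le> (1 / 2) ^ i"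
begin

definition L :: "(nat \<Rightarrow> real) \<Rightarrow> 'a \<Rightarrow> real" where
  "L z A = (\<Sum>i. z i * \<tau> i A)"

definition body :: "('a \<Rightarrow> real) set" where
  "body = L ` simplex_slice m"

lemma summable_bound:
  assumes "\<And>i. \<bar>z i\<bar> \<le> 2"
  shows "summable (\<lambda>i. \<bar>z i * \<tau> i A\<bar>)"
proof (rule summable_comparison_test')
  show "summable (\<lambda>i. 2 * \<bar>\<tau> i A\<bar>)" using summ by (rule summable_mult)
  show "norm \<bar>z i * \<tau> i A\<bar> \<le> 2 * \<bar>\<tau> i A\<bar>" for i
    using assms[of i] by (simp add: abs_mult mult_right_mono)
qed

lemma summable_slice:
  assumes "z \<in> simplex_slice m"
  shows "summable (\<lambda>i. \<bar>z i * \<tau> i A\<bar>)" and "summable (\<lambda>i. z i * \<tau> i A)"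
proof -
  show "summable (\<lambda>i. \<bar>z i * \<tau> i A\<bar>)"
    using simplex_sliceD[OF assms] by (intro summable_bound) auto
  then show "summable (\<lambda>i. z i * \<tau> i A)" by (rule summable_rabs_cancel)
qed

lemma L_split:
  assumes "z \<in> simplex_slice m"
  shows "L z A = (\<Sum>i<N. z i * \<tau> i A) + (\<Sum>i. z (i + N) * \<tau> (i + N) A)"
  unfolding L_def using suminf_split_initial_segment[OF summable_slice(2)[OF assms], where k = N] by simp

lemma L_tail_le:
  assumes "z \<in> simplex_slice m"
    and g: "\<And>i. N \<le> i \<Longrightarrow> \<bar>\<tau> i A\<bar> \<le> g i" and sg: "summable g"
  shows "\<bar>L z A - (\<Sum>i<N. z i * \<tau> i A)\<bar> \<le> 2 * (\<Sum>i. g (i + N))"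
proof -
  have "\<bar>\<Sum>i. z (i + N) * \<tau> (i + N) A\<bar> \<le> (\<Sum>i. \<bar>z (i + N) * \<tau> (i + N) A\<bar>)"
    using summable_ignore_initial_segment[OF summable_slice(1)[OF assms(1)], of N] by (intro summable_rabs)
  also have "\<dots> \<le> (\<Sum>i. 2 * g (i + N))"
  proof (rule suminf_le)
    show "\<bar>z (i + N) * \<tau> (i + N) A\<bar> \<le> 2 * g (i + N)" for i
      unfolding abs_mult using g[of "i + N"] simplex_sliceD(1,4)[OF assms(1), of "i + N"]
      by (intro mult_mono) auto
    show "summable (\<lambda>i. \<bar>z (i + N) * \<tau> (i + N) A\<bar>)"
      using summable_slice(1)[OF assms(1)] by (rule summable_ignore_initial_segment)
    show "summable (\<lambda>i. 2 * g (i + N))" using sg by (simp add: summable_mult summable_ignore_initial_segment)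
  qed
  also have "\<dots> = 2 * (\<Sum>i. g (i + N))"
    using sg by (intro suminf_mult) (simp add: summable_ignore_initial_segment)
  finally show ?thesis using L_split[OF assms(1), where A = A and N = N] by simp
qed

lemma linear_L: "z \<in> simplex_slice m \<Longrightarrow> linear (L z)"
  unfolding L_def
  by (intro linearI)
    (simp_all add: linear_add[OF lin] linear_cmul[OF lin] distrib_left mult.left_commute
      suminf_add summable_slice suminf_mult)

text \<open>Coefficients in the slice are at most 2, so by the Weierstrass test the series at a
  fixed vector converges uniformly over the slice.\<close>

lemma continuous_on_L: "continuous_on (simplex_slice m) L"
proof (rule continuous_on_coordinatewise_then_product)
  fix A
  have "uniform_limit (simplex_slice m) (\<lambda>n z. \<Sum>i<n. z i * \<tau> i A) (\<lambda>z. \<Sum>i. z i * \<tau> i A) sequentially"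
  proof (rule Weierstrass_m_test)
    show "summable (\<lambda>i. 2 * \<bar>\<tau> i A\<bar>)" using summ by (rule summable_mult)
    show "norm (z i * \<tau> i A) \<le> 2 * \<bar>\<tau> i A\<bar>" if "z \<in> simplex_slice m" for i z
      using simplex_sliceD(1,4)[OF that, of i] by (simp add: abs_mult mult_right_mono)
  qed
  then have "continuous_on (simplex_slice m) (\<lambda>z. \<Sum>i. z i * \<tau> i A)"
  proof (rule uniform_limit_theorem[rotated])
    have "continuous_on (simplex_slice m) (\<lambda>z. \<Sum>i<n. z i * \<tau> i A)" for n
      by (intro continuous_intros continuous_on_subset[OF continuous_on_product_coordinates]) auto
    then show "\<forall>\<^sub>F n in sequentially. continuous_on (simplex_slice m) (\<lambda>z. \<Sum>i<n. z i * \<tau> i A)"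
      by simp
  qed simp
  then show "continuous_on (simplex_slice m) (\<lambda>z. L z A)" by (simp add: L_def)
qed

lemma compact_body: "compact body"
  unfolding body_def by (intro compact_continuous_image continuous_on_L compact_simplex_slice)

lemma body_nonempty: "body \<noteq> {}"
  using unit_mem_simplex_slice[OF m_pos] by (auto simp: body_def)

lemma fconvex_body: "fconvex body"
  unfolding fconvex_def
proof (intro ballI allI impI)
  fix s t and u :: real assume "s \<in> body" "t \<in> body" and u: "0 \<le> u \<and> u \<le> 1"
  then obtain z w where zw: "z \<in> simplex_slice m" "w \<in> simplex_slice m" "s = L z" "t = L w"
    by (auto simp: body_def)
  have "(\<lambda>A. u * s A + (1 - u) * t A) = L (\<lambda>i. u * z i + (1 - u) * w i)"
    using summable_slice(2)[OF zw(1)] summable_slice(2)[OF zw(2)]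
    by (simp add: zw L_def fun_eq_iff suminf_mult[symmetric] suminf_add summable_mult distrib_right mult.assoc)
  then show "(\<lambda>A. u * s A + (1 - u) * t A) \<in> body"
    using convex_comb_mem_simplex_slice[OF zw(1,2)] u by (auto simp: body_def)
qed

text \<open>The maximiser is unique: otherwise the midpoint of two of them could be moved along coordinate k.\<close>

lemma exists_exposing_maximizer:
  assumes k: "m \<le> k" and pos: "0 < \<tau> k A"
  obtains w where "w \<in> simplex_slice m" "L w \<in> exposed_points body"
    "\<And>z. z \<in> simplex_slice m \<Longrightarrow> L z A \<le> L w A"
proof -
  have "\<exists>w\<in>simplex_slice m. \<forall>z\<in>simplex_slice m. L z A \<le> L w A"
    using unit_mem_simplex_slice[OF m_pos] continuous_on_product_then_coordinatewise[OF continuous_on_L]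
    by (intro continuous_attains_sup compact_simplex_slice) auto
  then obtain w where w: "w \<in> simplex_slice m" and max: "\<And>z. z \<in> simplex_slice m \<Longrightarrow> L z A \<le> L w A"
    by blast
  have "L z A < L w A" if z: "z \<in> simplex_slice m" and ne: "z \<noteq> w" for z
  proof (rule ccontr)
    assume "\<not> L z A < L w A"
    then have eq: "L z A = L w A" using max[OF z] by simp
    obtain t where t: "0 < t" and mem: "(\<lambda>i. (z i + w i) / 2 + (if i = k then t else 0)) \<in> simplex_slice m"
      using midpoint_plus_mem_simplex_slice[OF z w ne k] by blast
    have "(\<lambda>i. ((z i + w i) / 2 + (if i = k then t else 0)) * \<tau> i A) sums
        ((L z A + L w A) / 2 + t * \<tau> k A)"
    proof -
      have "(\<lambda>i. (z i * \<tau> i A + w i * \<tau> i A) / 2) sums ((L z A + L w A) / 2)"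
        unfolding L_def
        using summable_slice(2)[OF z] summable_slice(2)[OF w] by (intro sums_divide sums_add summable_sums)
      moreover have "(\<lambda>i. if i = k then t * \<tau> i A else 0) sums (t * \<tau> k A)"
        using sums_single[of k "\<lambda>i. t * \<tau> i A"] by simp
      ultimately have "(\<lambda>i. (z i * \<tau> i A + w i * \<tau> i A) / 2 + (if i = k then t * \<tau> i A else 0)) sums
        ((L z A + L w A) / 2 + t * \<tau> k A)" by (rule sums_add)
      moreover have "(z i * \<tau> i A + w i * \<tau> i A) / 2 + (if i = k then t * \<tau> i A else 0)
          = ((z i + w i) / 2 + (if i = k then t else 0)) * \<tau> i A" for i
        by (simp add: field_simps)
      ultimately show ?thesis by simp
    qed
    then have "L (\<lambda>i. (z i + w i) / 2 + (if i = k then t else 0)) A = L w A + t * \<tau> k A"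
      using eq by (simp add: L_def sums_iff)
    then show False using max[OF mem] t pos by (simp add: mult_le_0_iff)
  qed
  \<comment> \<open>Strictness passes from the slice to the body: a point of \<open>body\<close>
    other than \<open>L w\<close> has only preimages other than \<open>w\<close>.\<close>
  then have "L w \<in> exposed_points body"
    using w by (fastforce simp: exposed_points_def body_def)
  then show thesis using that w max by blast
qed

text \<open>Stability in the Cauchy-Schwarz inequality: for w in the slice, the squared distance to
  z over finitely many coordinates is at most 4 minus twice the inner product with z. The test
  vector \<open>A N\<close> evaluates to this inner product up to a multiple of
  \<open>(1 / 2) ^ N\<close>, so its maximiser nearly attains the value 2 and must be close to
  z.\<close>

lemma full_point_in_closure:
  assumes z: "z \<in> simplex_slice m" and M: "m \<le> M" and supp: "\<And>i. M \<le> i \<Longrightarrow> z i = 0"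
    and full: "(\<Sum>i<M. (z i)\<^sup>2) = 2"
  shows "L z \<in> closure (exposed_points body)"
proof -
  obtain k where k: "m \<le> k" "k < M" "0 < z k" using full_point_has_tail[OF z M full] by blast
  \<comment> \<open>The support bound \<open>M\<close> is fixed while \<open>N\<close> grows:
    \<open>A N\<close> takes the value \<open>z i\<close> at all i < N, zeros included, and only
    indices i \<ge> N contribute an error.\<close>
  define A where "A N = (\<Sum>j<M. z j *\<^sub>R B N j)" for N
  have tA: "\<tau> i (A N) = (\<Sum>j<M. z j * \<tau> i (B N j))" for i N
    by (simp add: A_def linear_sum[OF lin] linear_cmul[OF lin])
  have head: "\<tau> i (A N) = z i" if "M \<le> N" "i < N" for i N
  proof -
    have "\<tau> i (A N) = (\<Sum>j<M. if j = i then z j else 0)"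
      unfolding tA using that M by (intro sum.cong) (auto simp: dual)
    then show ?thesis using supp[of i] by auto
  qed
  have small: "\<bar>\<tau> i (A N)\<bar> \<le> 2 * M * (1 / 2) ^ i" if "M \<le> N" "N \<le> i" for i N
  proof -
    have "\<bar>\<tau> i (A N)\<bar> \<le> (\<Sum>j<M. \<bar>z j * \<tau> i (B N j)\<bar>)" unfolding tA by (rule sum_abs)
    also have "\<dots> \<le> (\<Sum>j<M. 2 * (1 / 2) ^ i)"
      using simplex_sliceD[OF z] that M tail[of N _ i]
      by (intro sum_mono) (auto simp: abs_mult intro!: mult_mono)
    finally show ?thesis by simp
  qed
  have "\<exists>w. w \<in> simplex_slice m \<and> L w \<in> exposed_points body \<and> (\<forall>i. (w i - z i)\<^sup>2 \<le> 16 * M * (1 / 2) ^ N)"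
    if N: "M \<le> N" for N
  proof -
    have "0 < \<tau> k (A N)" using head[of N k] k N by simp
    then obtain w where w: "w \<in> simplex_slice m" "L w \<in> exposed_points body"
      and max: "L z (A N) \<le> L w (A N)"
      using exists_exposing_maximizer[OF k(1)] z by metis
    have geo: "(\<Sum>i. 2 * real M * (1 / 2) ^ (i + N)) = 4 * M * (1 / 2) ^ N"
      using suminf_geometric[of "1 / 2 :: real"]
      by (simp add: power_add mult.assoc[symmetric] suminf_mult2[symmetric] suminf_mult summable_geometric summable_mult2)
    have sumM: "(\<Sum>i<N. x i * \<tau> i (A N)) = (\<Sum>i<M. x i * z i)" for x
    proof -
      have "(\<Sum>i<N. x i * \<tau> i (A N)) = (\<Sum>i<N. x i * z i)"
        using head[OF N] by (intro sum.cong) auto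
      also have "\<dots> = (\<Sum>i<M. x i * z i)"
        using N supp by (intro sum.mono_neutral_right) auto
      finally show ?thesis .
    qed
    have "L z (A N) = 2"
    proof -
      have "(\<Sum>i. z (i + N) * \<tau> (i + N) (A N)) = 0" using supp N by simp
      then show ?thesis using L_split[OF z, of "A N" N] sumM[of z] full by (simp add: power2_eq_square)
    qed
    moreover have "\<bar>L w (A N) - (\<Sum>i<N. w i * \<tau> i (A N))\<bar> \<le> 2 * (\<Sum>i. 2 * real M * (1 / 2) ^ (i + N))"
      using small[OF N] by (intro L_tail_le[OF w(1)] summable_mult summable_geometric) auto
    \<comment> \<open>The majorant \<open>2 * M * (1 / 2) ^ i\<close> sums to
      \<open>4 * M * (1 / 2) ^ N\<close> from N on, and coordinates up to 2 double it; the distance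
      estimate below doubles it again, to 16.\<close>
    ultimately have inner: "2 - 8 * M * (1 / 2) ^ N \<le> (\<Sum>i<M. w i * z i)"
      using max geo sumM[of w] by linarith
    have "(w i - z i)\<^sup>2 \<le> 16 * M * (1 / 2) ^ N" for i
    proof -
      define n where "n = max M (Suc i)"
      have "(w i - z i)\<^sup>2 \<le> (\<Sum>i<n. (w i - z i)\<^sup>2)"
        by (intro member_le_sum[of i _ "\<lambda>i. (w i - z i)\<^sup>2"]) (auto simp: n_def)
      also have "\<dots> = (\<Sum>i<n. (w i)\<^sup>2) + (\<Sum>i<n. (z i)\<^sup>2) - 2 * (\<Sum>i<n. w i * z i)"
        unfolding sum_distrib_left sum.distrib[symmetric] sum_subtractf[symmetric]
        by (rule sum.cong) (auto simp: power2_eq_square algebra_simps)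
      also have "(\<Sum>i<n. w i * z i) = (\<Sum>i<M. w i * z i)"
        using supp by (intro sum.mono_neutral_right) (auto simp: n_def)
      also have "(\<Sum>i<n. (w i)\<^sup>2) + (\<Sum>i<n. (z i)\<^sup>2) - 2 * (\<Sum>i<M. w i * z i) \<le> 16 * M * (1 / 2) ^ N"
        using simplex_sliceD(3)[OF w(1), of n] simplex_sliceD(3)[OF z, of n] inner by linarith
      finally show ?thesis .
    qed
    then show ?thesis using w by blast
  qed
  then obtain w where w: "\<And>N. M \<le> N \<Longrightarrow> w N \<in> simplex_slice m"
      "\<And>N. M \<le> N \<Longrightarrow> L (w N) \<in> exposed_points body"
      "\<And>N i. M \<le> N \<Longrightarrow> (w N i - z i)\<^sup>2 \<le> 16 * M * (1 / 2) ^ N"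
    by metis
  have "(\<lambda>N. w (N + M)) \<longlonglongrightarrow> z"
  proof (rule tendsto_pointwise)
    fix i
    have "(\<lambda>N. (w (N + M) i - z i)\<^sup>2) \<longlonglongrightarrow> 0"
    proof (rule tendsto_sandwich[OF _ _ tendsto_const])
      show "(\<lambda>N. 16 * real M * (1 / 2) ^ (N + M)) \<longlonglongrightarrow> 0"
        by (intro tendsto_mult_right_zero LIMSEQ_ignore_initial_segment LIMSEQ_power_zero) simp
    qed (use w(3) in auto)
    then have "(\<lambda>N. w (N + M) i - z i) \<longlonglongrightarrow> 0" by (simp add: tendsto_null_power)
    then show "(\<lambda>N. w (N + M) i) \<longlonglongrightarrow> z i" by (simp add: LIM_zero_iff)
  qed
  then have "(\<lambda>N. L (w (N + M))) \<longlonglongrightarrow> L z"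
    using z w(1) by (intro continuous_on_tendsto_compose[OF continuous_on_L]) auto
  then show ?thesis
    by (rule Lim_in_closed_set[OF closed_closure, rotated 2])
      (use w(2) closure_subset[of "exposed_points body"] in \<open>auto intro!: always_eventually\<close>)
qed

lemma body_subset_closure: "body \<subseteq> closure (exposed_points body)"
proof
  fix s assume "s \<in> body"
  then obtain z where z: "z \<in> simplex_slice m" and s: "s = L z" by (auto simp: body_def)
  text \<open>Cut z off at index N and use coordinate N to saturate the quadratic constraint.\<close>
  define w where "w N i = (if i < N then z i else if i = N then sqrt (2 - (\<Sum>i<N. (z i)\<^sup>2)) else 0)" for N i
  have w_head: "(\<Sum>i<N. f (w N i)) = (\<Sum>i<N. f (z i))" for f :: "real \<Rightarrow> real" and N
    by (rule sum.cong) (auto simp: w_def)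
  have full: "(\<Sum>i<Suc N. (w N i)\<^sup>2) = 2" for N
    using w_head[of "\<lambda>x. x\<^sup>2" N] simplex_sliceD(3)[OF z, of N] by (simp add: w_def)
  have w_mem: "w N \<in> simplex_slice m" if N: "m \<le> N" for N
  proof -
    have "(\<Sum>i<n. (w N i)\<^sup>2) \<le> 2" for n
    proof -
      have "(\<Sum>i<n. (w N i)\<^sup>2) \<le> (\<Sum>i<max n (Suc N). (w N i)\<^sup>2)" by (intro sum_mono2) auto
      also have "\<dots> = (\<Sum>i<Suc N. (w N i)\<^sup>2)" by (intro sum.mono_neutral_right) (auto simp: w_def)
      finally show ?thesis using full by simp
    qed
    moreover have "(\<Sum>i<m. w N i) = (\<Sum>i<m. z i)" using N by (intro sum.cong) (auto simp: w_def)
    moreover have "0 \<le> w N i" for i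
      using simplex_sliceD(1,3)[OF z] by (auto simp: w_def)
    ultimately show ?thesis using simplex_sliceD(2)[OF z] by (auto simp: simplex_slice_def)
  qed
  \<comment> \<open>The shift by \<open>m\<close> keeps the saturating coordinate outside the first
    m, whose sum must remain 1.\<close>
  have "(\<lambda>N. w (N + m)) \<longlonglongrightarrow> z"
  proof (rule tendsto_pointwise)
    fix i
    have "\<forall>\<^sub>F N in sequentially. z i = w (N + m) i"
      using eventually_gt_at_top[of i] by eventually_elim (simp add: w_def)
    then show "(\<lambda>N. w (N + m) i) \<longlonglongrightarrow> z i" by (rule Lim_transform_eventually[OF tendsto_const])
  qed
  then have lim: "(\<lambda>N. L (w (N + m))) \<longlonglongrightarrow> L z"
    using z w_mem by (intro continuous_on_tendsto_compose[OF continuous_on_L]) auto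
  have "L (w (N + m)) \<in> closure (exposed_points body)" for N
    using w_mem[of "N + m"] full[of "N + m"]
    by (intro full_point_in_closure[of _ "Suc (N + m)"]) (auto simp: w_def)
  then show "s \<in> closure (exposed_points body)"
    unfolding s by (intro Lim_in_closed_set[OF closed_closure _ _ lim]) (auto intro!: always_eventually)
qed

lemma closure_exposed_points_body: "closure (exposed_points body) = body"
proof
  show "closure (exposed_points body) \<subseteq> body"
    using compact_fun_imp_closed[OF compact_body] by (intro closure_minimal) (auto simp: exposed_points_def)
qed (rule body_subset_closure)

end

section \<open>Positive functionals and order units\<close>

lemma continuous_map_tvs_line:
  assumes "is_tvs T"
  shows "continuous_map euclideanreal T (\<lambda>c. c *\<^sub>R x)"
proof -
  have "continuous_map euclideanreal (prod_topology euclideanreal T) (\<lambda>c. (c, x))"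
    using assms by (auto simp: continuous_map_pairedI is_tvs_def)
  then have "continuous_map euclideanreal T ((\<lambda>(c, x). c *\<^sub>R x) \<circ> (\<lambda>c. (c, x)))"
    using assms unfolding is_tvs_def by (blast intro: continuous_map_compose)
  then show ?thesis by (simp add: o_def)
qed

lemma continuous_map_tvs_affine:
  assumes "is_tvs T"
  shows "continuous_map T T (\<lambda>x. a + c *\<^sub>R x)"
proof -
  have top: "topspace T = UNIV" using assms by (simp add: is_tvs_def)
  have "continuous_map T (prod_topology euclideanreal T) (\<lambda>x. (c, x))"
    using top by (auto simp: continuous_map_pairedI)
  then have "continuous_map T T ((\<lambda>(c, x). c *\<^sub>R x) \<circ> (\<lambda>x. (c, x)))"
    using assms unfolding is_tvs_def by (blast intro: continuous_map_compose)
  then have "continuous_map T (prod_topology T T) (\<lambda>x. (a, c *\<^sub>R x))"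
    using top by (auto simp: continuous_map_pairedI o_def)
  then have "continuous_map T T ((\<lambda>(x, y). x + y) \<circ> (\<lambda>x. (a, c *\<^sub>R x)))"
    using assms unfolding is_tvs_def by (blast intro: continuous_map_compose)
  then show ?thesis by (simp add: o_def)
qed

lemma openin_tvs_affine:
  assumes "is_tvs T" "openin T V"
  shows "openin T {x. a + c *\<^sub>R x \<in> V}"
  using openin_continuous_map_preimage[OF continuous_map_tvs_affine[OF assms(1)] assms(2), of a c] assms(1)
  by (simp add: is_tvs_def)

lemma nbhd0_mono: "nbhd0 T V \<Longrightarrow> V \<subseteq> W \<Longrightarrow> nbhd0 T W"
  unfolding nbhd0_def by blast

lemma nbhd0_Int: "nbhd0 T V \<Longrightarrow> nbhd0 T W \<Longrightarrow> nbhd0 T (V \<inter> W)"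
  unfolding nbhd0_def by (metis Int_iff Int_mono openin_Int)

lemma nbhd0_scale:
  assumes "is_tvs T" "nbhd0 T V"
  shows "nbhd0 T {x. c *\<^sub>R x \<in> V}"
proof -
  obtain O' where "openin T O'" "0 \<in> O'" "O' \<subseteq> V" using assms(2) by (auto simp: nbhd0_def)
  then show ?thesis
    unfolding nbhd0_def using openin_tvs_affine[OF assms(1), of O' 0 c]
    by (intro exI[of _ "{x. c *\<^sub>R x \<in> O'}"]) auto
qed

lemma nbhd0_absorbing:
  assumes "is_tvs T" "nbhd0 T V"
  obtains d where "0 < d" "\<And>c. \<bar>c\<bar> \<le> d \<Longrightarrow> c *\<^sub>R x \<in> V"
proof -
  obtain O' where O': "openin T O'" "0 \<in> O'" "O' \<subseteq> V" using assms(2) by (auto simp: nbhd0_def)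
  have "openin euclideanreal {c. c *\<^sub>R x \<in> O'}"
    using openin_continuous_map_preimage[OF continuous_map_tvs_line[OF assms(1)] O'(1), of x] by simp
  then have "open {c. c *\<^sub>R x \<in> O'}" by simp
  then obtain d where "0 < d" "cball 0 d \<subseteq> {c. c *\<^sub>R x \<in> O'}"
    using O'(2) by (metis (mono_tags, lifting) mem_Collect_eq open_contains_cball scaleR_zero_left)
  moreover have "c \<in> cball 0 d" if "\<bar>c\<bar> \<le> d" for c using that by simp
  ultimately show thesis using that[of d] O'(3) by blast
qed

lemma bounded_linear_in_cdual:
  assumes tvs: "is_tvs T" and lin: "linear f" and W: "nbhd0 T W" and bd: "\<And>v. v \<in> W \<Longrightarrow> \<bar>f v\<bar> \<le> M"
  shows "f \<in> cdual T"
proof -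
  obtain V where V: "openin T V" "0 \<in> V" "V \<subseteq> W" using W by (auto simp: nbhd0_def)
  have "openin T {x. f x \<in> Q}" if Q: "open Q" for Q
  proof (subst openin_subopen, intro ballI)
    fix x assume "x \<in> {x. f x \<in> Q}"
    then obtain r where r: "0 < r" "ball (f x) r \<subseteq> Q" using Q by (auto simp: open_contains_ball)
    \<comment> \<open>On the neighborhood the values of \<open>f\<close> are at most M, so this
      scale bounds the change of \<open>f\<close> by M / k < r; the summand 1 gives strictness and
      keeps \<open>k\<close> positive.\<close>
    define k where "k = (\<bar>M\<bar> + 1) / r"
    have k: "0 < k" using r by (simp add: k_def)
    have "f y \<in> Q" if "- k *\<^sub>R x + k *\<^sub>R y \<in> V" for y
    proof -
      have "\<bar>f (- k *\<^sub>R x + k *\<^sub>R y)\<bar> \<le> M" using that V bd by blast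
      moreover have "f (- k *\<^sub>R x + k *\<^sub>R y) = k * (f y - f x)"
        by (simp only: linear_add[OF lin] linear_cmul[OF lin]) (simp add: algebra_simps)
      ultimately have "k * \<bar>f y - f x\<bar> \<le> M" using k by (simp add: abs_mult)
      then have "k * \<bar>f y - f x\<bar> < k * r" using r by (simp add: k_def)
      then show ?thesis using k r by (auto simp: dist_real_def)
    qed
    then show "\<exists>Y. openin T Y \<and> x \<in> Y \<and> Y \<subseteq> {x. f x \<in> Q}"
      using openin_tvs_affine[OF tvs V(1), of "- k *\<^sub>R x" k] V(2)
      by (intro exI[of _ "{y. - k *\<^sub>R x + k *\<^sub>R y \<in> V}"]) auto
  qed
  then have "continuous_map T euclideanreal f"
    using tvs by (simp add: continuous_map_def is_tvs_def)
  then show ?thesis using lin by (simp add: cdual_def)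
qed

text \<open>Absorption scales the vector into the neighborhood by a factor independent of the
  functional. The bound is what makes finite nets in \<open>C\<close> possible.\<close>

lemma polar_pointwise_bounded:
  assumes "is_tvs T" "nbhd0 T V"
  obtains b where "\<And>s. s \<in> polar T V \<Longrightarrow> \<bar>s A\<bar> \<le> b"
proof -
  obtain d where d: "0 < d" "\<And>c. \<bar>c\<bar> \<le> d \<Longrightarrow> c *\<^sub>R A \<in> V" using nbhd0_absorbing[OF assms] by blast
  have "\<bar>s A\<bar> \<le> 1 / d" if "s \<in> polar T V" for s
  proof -
    have "\<bar>s (d *\<^sub>R A)\<bar> \<le> 1" "linear s" using that d by (auto simp: polar_def cdual_def)
    then show ?thesis using d by (simp add: linear_cmul abs_mult field_simps)
  qed
  then show thesis using that by blast
qed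

text \<open>The order interval \<open>[-e, e]\<close>. Estimates that are uniform over it act like a
  dual norm, and positive functionals are bounded on it by their value at \<open>e\<close>.\<close>

definition unit_nbhd :: "'a::real_vector set \<Rightarrow> 'a \<Rightarrow> 'a set" where
  "unit_nbhd P e = {v. e + v \<in> P \<and> e - v \<in> P}"

locale order_unit_tvs =
  fixes T :: "'a::real_vector topology" and P :: "'a set" and e :: 'a
  assumes tvs: "is_tvs T" and cone: "pos_convex_cone P" and unit: "nbhd0 T (unit_nbhd P e)"
begin

lemma cone_add: "A \<in> P \<Longrightarrow> B \<in> P \<Longrightarrow> A + B \<in> P"
  and cone_scale: "A \<in> P \<Longrightarrow> 0 < l \<Longrightarrow> l *\<^sub>R A \<in> P"
  using cone by (auto simp: pos_convex_cone_def)

lemma unit_mem: "e \<in> P"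
  using unit by (auto simp: nbhd0_def unit_nbhd_def)

lemma positive_bound:
  fixes f :: "'a \<Rightarrow> real"
  assumes "linear f" "\<And>A. A \<in> P \<Longrightarrow> 0 \<le> f A" "v \<in> unit_nbhd P e"
  shows "\<bar>f v\<bar> \<le> f e"
proof -
  have "0 \<le> f (e + v)" "0 \<le> f (e - v)" using assms by (auto simp: unit_nbhd_def)
  then show ?thesis unfolding linear_add[OF assms(1)] linear_diff[OF assms(1)] by linarith
qed

text \<open>Continuity is automatic, since the functional is bounded on the neighborhood
  \<open>unit_nbhd P e\<close>. New functionals need to be checked only for linearity and
  positivity.\<close>

lemma positive_in_dual_pos:
  fixes f :: "'a \<Rightarrow> real"
  assumes "linear f" "\<And>A. A \<in> P \<Longrightarrow> 0 \<le> f A"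
  shows "f \<in> dual_pos T P"
  using bounded_linear_in_cdual[OF tvs assms(1) unit positive_bound[OF assms]] assms(2)
  by (auto simp: dual_pos_def)

lemma dual_posD:
  assumes "f \<in> dual_pos T P"
  shows "linear f" and "A \<in> P \<Longrightarrow> 0 \<le> f A" and "v \<in> unit_nbhd P e \<Longrightarrow> \<bar>f v\<bar> \<le> f e"
  using assms positive_bound[of f] by (auto simp: dual_pos_def cdual_def)

lemma dual_pos_scale: "f \<in> dual_pos T P \<Longrightarrow> 0 \<le> c \<Longrightarrow> (\<lambda>A. c * f A) \<in> dual_pos T P"
  using linear_compose_scale_right[of f c] by (intro positive_in_dual_pos) (auto dest: dual_posD)

lemma dual_pos_add: "f \<in> dual_pos T P \<Longrightarrow> g \<in> dual_pos T P \<Longrightarrow> (\<lambda>A. f A + g A) \<in> dual_pos T P"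
  by (intro positive_in_dual_pos linear_compose_add) (auto intro!: add_nonneg_nonneg dest: dual_posD)

lemma unit_absorbs:
  obtains t where "0 < t" "t *\<^sub>R e - x \<in> P" "t *\<^sub>R e + x \<in> P"
proof -
  obtain d where d: "0 < d" "\<And>c. \<bar>c\<bar> \<le> d \<Longrightarrow> c *\<^sub>R x \<in> unit_nbhd P e"
    using nbhd0_absorbing[OF tvs unit] by blast
  then have "(1 / d) *\<^sub>R (e + d *\<^sub>R x) \<in> P" "(1 / d) *\<^sub>R (e - d *\<^sub>R x) \<in> P"
    using cone_scale[of _ "1 / d"] d(2)[of d] by (auto simp: unit_nbhd_def)
  then show thesis using that[of "1 / d"] d(1) by (simp add: algebra_simps)
qed

lemma gauge_set_nonempty: "{t. 0 \<le> t \<and> t *\<^sub>R e - x \<in> P} \<noteq> {}"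
  by (rule unit_absorbs[of x]) (use less_imp_le in blast)

text \<open>Restricting to nonnegative t makes the gauge vanish on the negative cone, so that every linear functional
  below it is positive.\<close>

definition gauge :: "'a \<Rightarrow> real" where
  "gauge x = Inf {t. 0 \<le> t \<and> t *\<^sub>R e - x \<in> P}"

lemma gauge_le: "0 \<le> t \<Longrightarrow> t *\<^sub>R e - x \<in> P \<Longrightarrow> gauge x \<le> t"
  unfolding gauge_def by (intro cInf_lower) (auto intro: bdd_belowI[of _ 0])

lemma gauge_nonneg: "0 \<le> gauge x"
  unfolding gauge_def
  by (intro cInf_greatest gauge_set_nonempty) auto

lemma gauge_lessD:
  assumes "gauge x < t"
  shows "t *\<^sub>R e - x \<in> P"
proof -
  obtain s where s: "s < t" "s *\<^sub>R e - x \<in> P"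
    using cInf_lessD[OF gauge_set_nonempty[of x] assms[unfolded gauge_def]] by blast
  then have "(t - s) *\<^sub>R e + (s *\<^sub>R e - x) \<in> P" using cone_add cone_scale unit_mem by simp
  then show ?thesis by (simp add: algebra_simps)
qed

lemma gauge_neg_cone: "A \<in> P \<Longrightarrow> gauge (- A) = 0"
  using gauge_le[of 0 "- A"] gauge_nonneg[of "- A"] by simp

lemma sublinear_gauge: "sublinear gauge"
proof (rule sublinearI)
  have bdd: "bdd_below {t. 0 \<le> t \<and> t *\<^sub>R e - x \<in> P}" for x by (auto intro: bdd_belowI[of _ 0])
  show "gauge (x + y) \<le> gauge x + gauge y" for x y
    unfolding gauge_def
  proof (rule Inf_le_add[OF gauge_set_nonempty gauge_set_nonempty bdd])
    fix s t assume "s \<in> {t. 0 \<le> t \<and> t *\<^sub>R e - x \<in> P}" "t \<in> {t. 0 \<le> t \<and> t *\<^sub>R e - y \<in> P}"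
    then show "\<exists>r\<in>{t. 0 \<le> t \<and> t *\<^sub>R e - (x + y) \<in> P}. r \<le> s + t"
      using cone_add[of "s *\<^sub>R e - x" "t *\<^sub>R e - y"] by (intro bexI[of _ "s + t"]) (auto simp: algebra_simps)
  qed
  show "gauge (c *\<^sub>R x) \<le> c * gauge x" if "0 < c" for c x
    unfolding gauge_def
  proof (rule Inf_le_scale[OF gauge_set_nonempty that bdd])
    fix t assume "t \<in> {t. 0 \<le> t \<and> t *\<^sub>R e - x \<in> P}"
    then show "\<exists>r\<in>{t. 0 \<le> t \<and> t *\<^sub>R e - c *\<^sub>R x \<in> P}. r \<le> c * t"
      using cone_scale[of "t *\<^sub>R e - x" c] that by (intro bexI[of _ "c * t"]) (auto simp: algebra_simps)
  qed
  \<comment> \<open>The cone is closed under positive multiples only and may miss 0, so t = 0 is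
    replaced by arbitrarily small t > 0.\<close>
  have "gauge 0 \<le> 0"
  proof (rule dense_ge)
    show "gauge 0 \<le> t" if "0 < t" for t using gauge_le[of t 0] cone_scale[OF unit_mem that] that by simp
  qed
  then show "gauge 0 = 0" using gauge_nonneg[of 0] by simp
qed

lemma positive_functional_attaining_gauge:
  obtains f where "f \<in> dual_pos T P" "f A = gauge A"
proof -
  obtain f where f: "linear f" "\<And>x. f x \<le> gauge x" "f A = gauge A"
    using Hahn_Banach_sublinear[OF sublinear_gauge] by blast
  have "0 \<le> f B" if "B \<in> P" for B
    using f(2)[of "- B"] gauge_neg_cone[OF that] by (simp add: linear_neg[OF f(1)])
  then show thesis using that positive_in_dual_pos f by blast
qed

text \<open>Vanishing of both gauges puts A between - d e and d e for every d > 0. An order interval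
  that contains a neighborhood contains - d e and d e for some such d, hence also A; since such
  intervals exist inside every neighborhood, the Hausdorff property forces A = 0. With Hahn-Banach
  this makes positive functionals separate points.\<close>

lemma gauge_definite:
  assumes haus: "Hausdorff_space T"
    and intervals: "\<And>U. nbhd0 T U \<Longrightarrow>
        \<exists>A1 A2 V. nbhd0 T V \<and> V \<subseteq> ord_interval P A1 A2 \<and> ord_interval P A1 A2 \<subseteq> U"
    and A: "gauge A = 0" "gauge (- A) = 0"
  shows "A = 0"
proof (rule ccontr)
  assume "A \<noteq> 0"
  moreover have top: "topspace T = UNIV" using tvs by (simp add: is_tvs_def)
  ultimately obtain O' where O': "openin T O'" "0 \<in> O'" "A \<notin> O'"
    using haus unfolding Hausdorff_space_def disjnt_iff by (metis UNIV_I)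
  then have "nbhd0 T O'" by (auto simp: nbhd0_def)
  from intervals[OF this] obtain A1 A2 V where
    V: "nbhd0 T V" "V \<subseteq> ord_interval P A1 A2" "ord_interval P A1 A2 \<subseteq> O'" by blast
  obtain d where d: "0 < d" "\<And>c. \<bar>c\<bar> \<le> d \<Longrightarrow> c *\<^sub>R e \<in> V" using nbhd0_absorbing[OF tvs V(1)] by blast
  have "d *\<^sub>R e \<in> ord_interval P A1 A2" "(- d) *\<^sub>R e \<in> ord_interval P A1 A2"
    using d(1) d(2)[of d] d(2)[of "- d"] V(2) by auto
  then have "- d *\<^sub>R e - A1 \<in> P" "A2 - d *\<^sub>R e \<in> P" by (auto simp: ord_interval_def)
  moreover have "d *\<^sub>R e - A \<in> P" "d *\<^sub>R e + A \<in> P"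
    using gauge_lessD[of A d] gauge_lessD[of "- A" d] A d(1) by auto
  ultimately have "(- d *\<^sub>R e - A1) + (d *\<^sub>R e + A) \<in> P" "(A2 - d *\<^sub>R e) + (d *\<^sub>R e - A) \<in> P"
    using cone_add by blast+
  then have "A \<in> ord_interval P A1 A2" by (simp add: ord_interval_def)
  then show False using V(3) O'(3) by blast
qed

end

text \<open>The interval hypothesis is applied to the whole space. If x and - x both lie above
  \<open>A1\<close>, then x lies between \<open>A1\<close> and \<open>- A1\<close>, so
  \<open>- A1\<close> is an order unit.\<close>

lemma interval_basis_order_unit:
  assumes "is_tvs T" "pos_convex_cone P"
    and "\<And>U. nbhd0 T U \<Longrightarrow>
        \<exists>A1 A2 V. nbhd0 T V \<and> V \<subseteq> ord_interval P A1 A2 \<and> ord_interval P A1 A2 \<subseteq> U"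
  obtains e where "order_unit_tvs T P e"
proof -
  have "nbhd0 T UNIV" using assms(1) by (auto simp: nbhd0_def is_tvs_def intro!: exI[of _ "topspace T"])
  from assms(3)[OF this] obtain A1 A2 V where V: "nbhd0 T V" "V \<subseteq> ord_interval P A1 A2" by blast
  have "nbhd0 T (V \<inter> {x. (- 1) *\<^sub>R x \<in> V})" by (intro nbhd0_Int nbhd0_scale assms(1) V(1))
  then have "nbhd0 T (unit_nbhd P (- A1))"
  proof (rule nbhd0_mono)
    show "V \<inter> {x. (- 1) *\<^sub>R x \<in> V} \<subseteq> unit_nbhd P (- A1)"
    proof
      fix x assume x: "x \<in> V \<inter> {x. (- 1) *\<^sub>R x \<in> V}"
      then have "- x \<in> V" "x \<in> V" by auto
      then have "- x - A1 \<in> P" "x - A1 \<in> P" using V(2) by (auto simp: ord_interval_def)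
      moreover have "- A1 + x = x - A1" "- A1 - x = - x - A1" by (simp_all add: algebra_simps)
      ultimately show "x \<in> unit_nbhd P (- A1)" unfolding unit_nbhd_def mem_Collect_eq by metis
    qed
  qed
  then show thesis using that assms by (simp add: order_unit_tvs_def)
qed

section \<open>Approximation\<close>

lemma fconvex_sum:
  fixes m :: nat
  assumes C: "fconvex C" and z: "\<And>i. i < m \<Longrightarrow> 0 \<le> z i" "(\<Sum>i<m. z i) = (1::real)"
    and c: "\<And>i. i < m \<Longrightarrow> c i \<in> C"
  shows "(\<lambda>A. \<Sum>i<m. z i * c i A) \<in> C"
  using z c
proof (induction m arbitrary: z)
  case 0
  then show ?case by simp
next
  case (Suc m)
  define r where "r = (\<Sum>i<m. z i)"
  have r: "0 \<le> r" "z m = 1 - r" "0 \<le> z m" using Suc.prems by (auto simp: r_def intro: sum_nonneg)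
  show ?case
  proof (cases "r = 0")
    case True
    then have "z i = 0" if "i < m" for i
      using that Suc.prems(1) sum_nonneg_eq_0_iff[of "{..<m}" z] by (simp add: r_def)
    then show ?thesis using True r Suc.prems(3)[of m] by simp
  next
    case False
    then have "(\<Sum>i<m. z i / r) = 1" by (simp add: r_def flip: sum_divide_distrib)
    then have "(\<lambda>A. \<Sum>i<m. z i / r * c i A) \<in> C"
      using Suc.IH[of "\<lambda>i. z i / r"] Suc.prems r by simp
    then have "(\<lambda>A. r * (\<Sum>i<m. z i / r * c i A) + (1 - r) * c m A) \<in> C"
      using C[unfolded fconvex_def] Suc.prems(3)[of m] r by simp
    moreover have "r * (\<Sum>i<m. z i / r * c i A) = (\<Sum>i<m. z i * c i A)" for A
      unfolding sum_distrib_left using False by (intro sum.cong) auto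
    ultimately show ?thesis using r by simp
  qed
qed

text \<open>Forward substitution: the vector correcting equation N is annihilated by all earlier
  functionals. The triangular hypothesis is the form of independence that can be secured while
  functionals are chosen one at a time.\<close>

lemma triangular_system_solvable:
  fixes t :: "nat \<Rightarrow> 'a::real_vector \<Rightarrow> real"
  assumes lin: "\<And>i. linear (t i)"
    and tri: "\<And>i. \<exists>A. (\<forall>k<i. t k A = 0) \<and> t i A \<noteq> 0"
  shows "\<exists>A. \<forall>i<N. t i A = y i"
proof (induction N)
  case (Suc N)
  then obtain A where A: "\<forall>i<N. t i A = y i" by blast
  obtain B where B: "\<forall>k<N. t k B = 0" "t N B \<noteq> 0" using tri by blast
  have "t i (A + ((y N - t N A) / t N B) *\<^sub>R B) = y i" if "i < Suc N" for i
    using that A B by (auto simp: linear_add[OF lin] linear_cmul[OF lin] less_Suc_eq)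
  then show ?case by blast
qed simp

text \<open>Values are divided by \<epsilon> and rounded down; boundedness leaves finitely many
  integer patterns, and one representative of each forms the net.\<close>

lemma finite_coordinate_net:
  fixes C :: "('a \<Rightarrow> real) set"
  assumes "0 < \<epsilon>" and bd: "\<And>A. \<exists>b. \<forall>s\<in>C. \<bar>s A\<bar> \<le> b"
  obtains F where "finite F" "F \<subseteq> C" "\<And>s. s \<in> C \<Longrightarrow> \<exists>t\<in>F. \<forall>k<n::nat. \<bar>s (d k) - t (d k)\<bar> \<le> \<epsilon>"
proof -
  obtain b where b: "\<And>A s. s \<in> C \<Longrightarrow> \<bar>s A\<bar> \<le> b A" using bd by metis
  define key where "key s = restrict (\<lambda>k. \<lfloor>s (d k) / \<epsilon>\<rfloor>) {..<n}" for s :: "'a \<Rightarrow> real"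
  have "key ` C \<subseteq> PiE {..<n} (\<lambda>k. {\<lfloor>- b (d k) / \<epsilon>\<rfloor>..\<lfloor>b (d k) / \<epsilon>\<rfloor>})"
  proof
    fix x assume "x \<in> key ` C"
    then obtain s where s: "s \<in> C" "x = key s" by blast
    have "- b (d k) / \<epsilon> \<le> s (d k) / \<epsilon>" "s (d k) / \<epsilon> \<le> b (d k) / \<epsilon>" for k
      using b[OF s(1), of "d k"] assms(1) by (intro divide_right_mono; simp)+
    then show "x \<in> PiE {..<n} (\<lambda>k. {\<lfloor>- b (d k) / \<epsilon>\<rfloor>..\<lfloor>b (d k) / \<epsilon>\<rfloor>})"
      by (auto simp: s(2) key_def intro!: floor_mono)
  qed
  then have fin: "finite (key ` C)" by (rule finite_subset) (auto intro: finite_PiE)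
  show thesis
  proof (rule that[of "inv_into C key ` key ` C"])
    fix s assume s: "s \<in> C"
    define t where "t = inv_into C key (key s)"
    have "key t = key s" unfolding t_def using s by (simp add: f_inv_into_f)
    have "\<bar>s (d k) - t (d k)\<bar> \<le> \<epsilon>" if "k < n" for k
    proof -
      have "\<lfloor>s (d k) / \<epsilon>\<rfloor> = \<lfloor>t (d k) / \<epsilon>\<rfloor>"
        using fun_cong[OF \<open>key t = key s\<close>, of k] that by (simp add: key_def)
      then have "\<bar>s (d k) / \<epsilon> - t (d k) / \<epsilon>\<bar> \<le> 1" by linarith
      then show ?thesis using assms(1) by (simp add: abs_divide flip: diff_divide_distrib)
    qed
    then show "\<exists>t\<in>inv_into C key ` key ` C. \<forall>k<n. \<bar>s (d k) - t (d k)\<bar> \<le> \<epsilon>"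
      using s by (auto simp: t_def)
  qed (use fin in \<open>auto intro: inv_into_into\<close>)
qed

section \<open>Choice of the functionals and of the approximating bodies\<close>

context order_unit_tvs
begin

text \<open>The dual bases B used at stage i involve only the functionals chosen before, and finitely many of them
  impose a smallness condition on the new functional; scaling therefore suffices beyond index m.\<close>

lemma exists_rapidly_decreasing_family:
  fixes c :: "nat \<Rightarrow> 'a \<Rightarrow> real"
  assumes kernel: "\<And>(t :: nat \<Rightarrow> 'a \<Rightarrow> real) n. (\<And>k. k < n \<Longrightarrow> linear (t k)) \<Longrightarrow> \<exists>A. A \<noteq> 0 \<and> (\<forall>k<n. t k A = 0)"
    and sep: "\<And>A. A \<noteq> 0 \<Longrightarrow> \<exists>f\<in>dual_pos T P. f A \<noteq> 0"
    and c: "\<And>i. c i \<in> dual_pos T P" and m: "0 < m" and \<epsilon>: "0 < \<epsilon>"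
  obtains \<tau> B where "rapidly_decreasing_family \<tau> m B" "\<And>i. \<tau> i \<in> dual_pos T P"
    "\<And>i v. i < m \<Longrightarrow> v \<in> unit_nbhd P e \<Longrightarrow> \<bar>\<tau> i v - c i v\<bar> \<le> \<epsilon>"
    "\<And>i. m \<le> i \<Longrightarrow> \<tau> i e \<le> \<epsilon> * (1 / 2) ^ i"
proof -
  \<comment> \<open>The choice by \<open>SOME\<close> lets the recursion refer to dual bases before
    they are known to exist; existence follows from the triangular condition once all functionals
    are chosen.\<close>
  define B where "B f N j = (SOME A. \<forall>i<N. f i A = (if i = j then 1 else 0))"
    for f :: "nat \<Rightarrow> 'a \<Rightarrow> real" and N j :: nat
  have B_cong: "B f N = B g N" if "\<And>k. k < N \<Longrightarrow> f k = g k" for f g :: "nat \<Rightarrow> 'a \<Rightarrow> real" and N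
    unfolding B_def fun_eq_iff using that by simp
  define Q where "Q f i r \<longleftrightarrow> r \<in> dual_pos T P
      \<and> (i < m \<longrightarrow> (\<forall>v\<in>unit_nbhd P e. \<bar>r v - c i v\<bar> \<le> \<epsilon>))
      \<and> (m \<le> i \<longrightarrow> r e \<le> \<epsilon> * (1 / 2) ^ i \<and> (\<forall>N\<le>i. \<forall>j<N. \<bar>r (B f N j)\<bar> \<le> (1 / 2) ^ i))
      \<and> (\<exists>A. (\<forall>k<i. f k A = 0) \<and> r A \<noteq> 0)" for f :: "nat \<Rightarrow> 'a \<Rightarrow> real" and i r
  have "\<exists>\<tau>. \<forall>i. Q \<tau> i (\<tau> i)"
  proof (rule dependent_wellorder_choice)
    fix r and f g :: "nat \<Rightarrow> 'a \<Rightarrow> real" and i :: nat assume eq: "\<And>k. k < i \<Longrightarrow> f k = g k"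
    then have "B f N = B g N" if "N \<le> i" for N using that by (intro B_cong) auto
    then show "Q f i r = Q g i r" using eq by (simp add: Q_def)
  next
    fix i f assume "\<And>k. k < i \<Longrightarrow> Q f k (f k)"
    then have "linear (f k)" if "k < i" for k using that by (auto simp: Q_def intro: dual_posD)
    then obtain A where A: "A \<noteq> 0" "\<forall>k<i. f k A = 0" using kernel[of i f] by blast
    obtain \<rho> where \<rho>: "\<rho> \<in> dual_pos T P" "\<rho> A \<noteq> 0" using sep A by blast
    have \<rho>e: "0 \<le> \<rho> e" using dual_posD(2)[OF \<rho>(1)] unit_mem by blast
    show "\<exists>r. Q f i r"
    proof (cases "i < m")
      case True
      \<comment> \<open>\<open>c i\<close> is kept if \<open>A\<close> already witnesses its
        independence; otherwise a small multiple of a positive functional not vanishing at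
        \<open>A\<close> is added, which stays in the cone.\<close>
      show ?thesis
      proof (cases "c i A = 0")
        case False
        then have "Q f i (c i)" using True c A(2) \<epsilon> by (auto simp: Q_def)
        then show ?thesis by blast
      next
        case cA: True
        define \<theta> where "\<theta> = \<epsilon> / (1 + \<rho> e)"
        have \<theta>: "0 < \<theta>" "0 \<le> \<theta>" "\<theta> * \<rho> e \<le> \<epsilon>" using \<epsilon> \<rho>e by (auto simp: \<theta>_def field_simps)
        have small: "\<bar>\<theta> * \<rho> v\<bar> \<le> \<epsilon>" if "v \<in> unit_nbhd P e" for v
          using order_trans[OF mult_left_mono[OF dual_posD(3)[OF \<rho>(1) that] \<theta>(2)] \<theta>(3)] \<theta>(2)
          by (simp add: abs_mult)
        have "(\<lambda>v. c i v + \<theta> * \<rho> v) \<in> dual_pos T P"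
          by (intro dual_pos_add dual_pos_scale c \<rho>(1) \<theta>(2))
        moreover have "c i A + \<theta> * \<rho> A \<noteq> 0" using cA \<theta>(1) \<rho>(2) by simp
        ultimately have "Q f i (\<lambda>v. c i v + \<theta> * \<rho> v)"
          unfolding Q_def using True A(2) small by auto
        then show ?thesis by blast
      qed
    next
      case False
      \<comment> \<open>\<open>M\<close> dominates \<rho> at \<open>e\<close> and at the finitely
        many dual vectors in play, so one factor \<theta> meets all bounds; the
        \<open>min 1 \<epsilon>\<close> in it serves both the bound with \<epsilon> and the bound
        without.\<close>
      define M where "M = 1 + \<rho> e + (\<Sum>N\<le>i. \<Sum>j<N. \<bar>\<rho> (B f N j)\<bar>)"
      have sum0: "0 \<le> (\<Sum>N\<le>i. \<Sum>j<N. \<bar>\<rho> (B f N j)\<bar>)" by (intro sum_nonneg) auto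
      have M: "0 < M" "\<rho> e \<le> M" using \<rho>e sum0 by (auto simp: M_def)
      have MB: "\<bar>\<rho> (B f N j)\<bar> \<le> M" if "N \<le> i" "j < N" for N j
      proof -
        have "\<bar>\<rho> (B f N j)\<bar> \<le> (\<Sum>j<N. \<bar>\<rho> (B f N j)\<bar>)"
          using that by (intro member_le_sum[of j _ "\<lambda>j. \<bar>\<rho> (B f N j)\<bar>"]) auto
        also have "\<dots> \<le> (\<Sum>N\<le>i. \<Sum>j<N. \<bar>\<rho> (B f N j)\<bar>)"
          using that by (intro member_le_sum[of N _ "\<lambda>N. \<Sum>j<N. \<bar>\<rho> (B f N j)\<bar>"]) (auto intro: sum_nonneg)
        finally show ?thesis using \<rho>e by (simp add: M_def)
      qed
      define \<theta> where "\<theta> = min 1 \<epsilon> * (1 / 2) ^ i / M"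
      have \<theta>: "0 < \<theta>" "0 \<le> \<theta>" "\<theta> * M = min 1 \<epsilon> * (1 / 2) ^ i" using M \<epsilon> by (auto simp: \<theta>_def)
      have "\<theta> * \<rho> e \<le> \<epsilon> * (1 / 2) ^ i"
        by (rule order_trans[OF mult_left_mono[OF M(2) \<theta>(2)]])
          (simp add: \<theta>(3) mult_right_mono del: power_divide)
      moreover have "\<bar>\<theta> * \<rho> (B f N j)\<bar> \<le> (1 / 2) ^ i" if "N \<le> i" "j < N" for N j
      proof -
        have "\<theta> * \<bar>\<rho> (B f N j)\<bar> \<le> \<theta> * M" by (rule mult_left_mono[OF MB[OF that] \<theta>(2)])
        also have "\<dots> \<le> 1 * (1 / 2) ^ i" unfolding \<theta>(3) by (rule mult_right_mono) auto
        finally show ?thesis using \<theta>(2) by (simp add: abs_mult)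
      qed
      moreover have "(\<lambda>v. \<theta> * \<rho> v) \<in> dual_pos T P" by (intro dual_pos_scale \<rho>(1) \<theta>(2))
      moreover have "\<theta> * \<rho> A \<noteq> 0" using \<theta>(1) \<rho>(2) by simp
      ultimately have "Q f i (\<lambda>v. \<theta> * \<rho> v)"
        unfolding Q_def using False A(2) by auto
      then show ?thesis by blast
    qed
  qed
  then obtain \<tau> where \<tau>: "\<And>i. Q \<tau> i (\<tau> i)" by blast
  have pos: "\<tau> i \<in> dual_pos T P" for i using \<tau>[of i] by (simp add: Q_def)
  have lin: "linear (\<tau> i)" for i using dual_posD(1)[OF pos] .
  have small: "\<tau> i e \<le> \<epsilon> * (1 / 2) ^ i" if "m \<le> i" for i using \<tau>[of i] that by (simp add: Q_def)
  have "\<exists>A. (\<forall>k<i. \<tau> k A = 0) \<and> \<tau> i A \<noteq> 0" for i using \<tau>[of i] by (simp add: Q_def)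
  then have "\<exists>A. \<forall>i<N. \<tau> i A = (if i = j then 1 else 0)" for N j
    by (rule triangular_system_solvable[OF lin])
  then have B: "\<forall>i<N. \<tau> i (B \<tau> N j) = (if i = j then 1 else 0)" for N j
    unfolding B_def by (rule someI_ex)
  have summable: "summable (\<lambda>i. \<bar>\<tau> i A\<bar>)" for A
  proof -
    obtain d where d: "0 < d" "\<And>c. \<bar>c\<bar> \<le> d \<Longrightarrow> c *\<^sub>R A \<in> unit_nbhd P e"
      using nbhd0_absorbing[OF tvs unit] by blast
    have "norm \<bar>\<tau> i A\<bar> \<le> \<epsilon> / d * (1 / 2) ^ i" if "m \<le> i" for i
    proof -
      have "\<bar>\<tau> i (d *\<^sub>R A)\<bar> \<le> \<tau> i e" using d by (intro dual_posD(3)[OF pos]) simp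
      then have "d * \<bar>\<tau> i A\<bar> \<le> \<epsilon> * (1 / 2) ^ i"
        using small[OF that] d(1) by (simp add: linear_cmul[OF lin] abs_mult)
      then show ?thesis using d(1) by (simp add: field_simps)
    qed
    moreover have "summable (\<lambda>i. \<epsilon> / d * (1 / 2 :: real) ^ i)"
      by (rule summable_mult[OF summable_geometric]) simp
    ultimately show ?thesis by (rule summable_comparison_test'[rotated])
  qed
  have "rapidly_decreasing_family \<tau> m (B \<tau>)"
  proof (rule rapidly_decreasing_family.intro)
    show "\<bar>\<tau> i (B \<tau> N j)\<bar> \<le> (1 / 2) ^ i" if "m \<le> N" "j < N" "N \<le> i" for N i j
      using \<tau>[of i] that by (simp add: Q_def)
    show "\<tau> i (B \<tau> N j) = (if i = j then 1 else 0)" if "i < N" for N i j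
      using B that by blast
  qed (rule lin summable m)+
  moreover have "\<bar>\<tau> i v - c i v\<bar> \<le> \<epsilon>" if "i < m" "v \<in> unit_nbhd P e" for i v
    using \<tau>[of i] that by (simp add: Q_def)
  ultimately show thesis using that pos small by metis
qed

text \<open>Errors are uniform over \<open>unit_nbhd P e\<close>, a neighborhood of 0, and therefore
  yield both membership in a polar and closeness at every vector.\<close>

lemma exists_approximant:
  fixes c :: "nat \<Rightarrow> 'a \<Rightarrow> real"
  assumes kernel: "\<And>(t :: nat \<Rightarrow> 'a \<Rightarrow> real) n. (\<And>k. k < n \<Longrightarrow> linear (t k)) \<Longrightarrow> \<exists>A. A \<noteq> 0 \<and> (\<forall>k<n. t k A = 0)"
    and sep: "\<And>A. A \<noteq> 0 \<Longrightarrow> \<exists>f\<in>dual_pos T P. f A \<noteq> 0"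
    and C: "fconvex C" "C \<subseteq> dual_pos T P" "\<And>i. c i \<in> C" and m: "0 < m" and \<epsilon>: "0 < \<epsilon>"
  obtains D where "D \<noteq> {}" "fconvex D" "closedin (wstar T) D" "D = (wstar T) closure_of (exposed_points D)"
    "D \<subseteq> dual_pos T P"
    "\<And>s. s \<in> D \<Longrightarrow> \<exists>t\<in>C. \<forall>v\<in>unit_nbhd P e. \<bar>s v - t v\<bar> \<le> \<epsilon>"
    "\<And>i. i < m \<Longrightarrow> \<exists>s\<in>D. \<forall>v\<in>unit_nbhd P e. \<bar>s v - c i v\<bar> \<le> \<epsilon>"
proof -
  \<comment> \<open>Budget: the first m coefficients sum to 1 and cost
    \<open>\<epsilon> / 5\<close>; tail coefficients are at most 2 and the geometric series sums to
    at most 2, which costs \<open>4 * \<epsilon> / 5\<close>.\<close>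
  obtain \<tau> B where rdf: "rapidly_decreasing_family \<tau> m B" and pos: "\<And>i. \<tau> i \<in> dual_pos T P"
    and near: "\<And>i v. i < m \<Longrightarrow> v \<in> unit_nbhd P e \<Longrightarrow> \<bar>\<tau> i v - c i v\<bar> \<le> \<epsilon> / 5"
    and small: "\<And>i. m \<le> i \<Longrightarrow> \<tau> i e \<le> \<epsilon> / 5 * (1 / 2) ^ i"
  proof (rule exists_rapidly_decreasing_family[OF kernel sep _ m, where c = c and \<epsilon> = "\<epsilon> / 5"])
    show "c i \<in> dual_pos T P" for i using C by blast
  qed (use \<epsilon> in auto)
  interpret rapidly_decreasing_family \<tau> m B by (rule rdf)
  have L_pos: "L z \<in> dual_pos T P" if z: "z \<in> simplex_slice m" for z
  proof (rule positive_in_dual_pos[OF linear_L[OF z]])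
    show "0 \<le> L z A" if "A \<in> P" for A
      unfolding L_def using dual_posD(2)[OF pos that] simplex_sliceD(1)[OF z]
      by (intro suminf_nonneg summable_slice(2)[OF z]) simp
  qed
  then have body_pos: "body \<subseteq> dual_pos T P" by (auto simp: body_def)
  then have body_cdual: "body \<subseteq> cdual T" by (auto simp: dual_pos_def)
  have wstar: "wstar T = top_of_set (cdual T)" by (simp add: wstar_def euclidean_product_topology)
  have near_comb: "\<bar>L z v - (\<Sum>i<m. z i * c i v)\<bar> \<le> \<epsilon>"
    if z: "z \<in> simplex_slice m" and v: "v \<in> unit_nbhd P e" for z v
  proof -
    have "\<bar>(\<Sum>i<m. z i * \<tau> i v) - (\<Sum>i<m. z i * c i v)\<bar> \<le> (\<Sum>i<m. \<bar>z i * \<tau> i v - z i * c i v\<bar>)"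
      unfolding sum_subtractf[symmetric] by (rule sum_abs)
    also have "\<dots> \<le> (\<Sum>i<m. z i * (\<epsilon> / 5))"
    proof (rule sum_mono)
      fix i assume "i \<in> {..<m}"
      then show "\<bar>z i * \<tau> i v - z i * c i v\<bar> \<le> z i * (\<epsilon> / 5)"
        using mult_left_mono[OF near[OF _ v, of i] simplex_sliceD(1)[OF z]] simplex_sliceD(1)[OF z, of i]
        by (simp add: abs_mult flip: right_diff_distrib)
    qed
    also have "\<dots> = \<epsilon> / 5" using simplex_sliceD(2)[OF z] by (simp flip: sum_distrib_right sum_divide_distrib)
    finally have head: "\<bar>(\<Sum>i<m. z i * \<tau> i v) - (\<Sum>i<m. z i * c i v)\<bar> \<le> \<epsilon> / 5" .
    have sg: "summable (\<lambda>i. \<epsilon> / 5 * (1 / 2) ^ i)" by (intro summable_mult summable_geometric) simp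
    have "\<bar>L z v - (\<Sum>i<m. z i * \<tau> i v)\<bar> \<le> 2 * (\<Sum>i. \<epsilon> / 5 * (1 / 2) ^ (i + m))"
      using dual_posD(3)[OF pos v] small by (intro L_tail_le[OF z _ sg]) (meson order_trans)
    also have "\<dots> \<le> 2 * (\<Sum>i. \<epsilon> / 5 * (1 / 2) ^ i)"
      using \<epsilon> by (intro mult_left_mono suminf_le summable_ignore_initial_segment[OF sg] sg)
        (auto intro: power_decreasing)
    also have "\<dots> = 4 * \<epsilon> / 5"
      by (subst suminf_mult) (auto simp: suminf_geometric)
    finally show ?thesis using head by linarith
  qed
  show thesis
  proof (rule that[of body])
    show "closedin (wstar T) body"
      using compact_fun_imp_closed[OF compact_body] body_cdual
      by (auto simp: wstar intro: closed_subset)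
    have "exposed_points body \<subseteq> cdual T" using body_cdual by (auto simp: exposed_points_def)
    then show "body = (wstar T) closure_of (exposed_points body)"
      using closure_exposed_points_body body_cdual
      by (simp add: wstar closure_of_subtopology Int_absorb1)
    show "\<exists>t\<in>C. \<forall>v\<in>unit_nbhd P e. \<bar>s v - t v\<bar> \<le> \<epsilon>" if "s \<in> body" for s
    proof -
      obtain z where z: "z \<in> simplex_slice m" "s = L z" using \<open>s \<in> body\<close> by (auto simp: body_def)
      have "(\<lambda>A. \<Sum>i<m. z i * c i A) \<in> C"
        using simplex_sliceD(1,2)[OF z(1)] C by (intro fconvex_sum) auto
      moreover have "\<forall>v\<in>unit_nbhd P e. \<bar>s v - (\<Sum>i<m. z i * c i v)\<bar> \<le> \<epsilon>"
        using near_comb[OF z(1)] z(2) by simp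
      ultimately show ?thesis by (intro bexI[of _ "\<lambda>A. \<Sum>i<m. z i * c i A"])
    qed
    show "\<exists>s\<in>body. \<forall>v\<in>unit_nbhd P e. \<bar>s v - c i v\<bar> \<le> \<epsilon>" if i: "i < m" for i
    proof -
      have "(\<Sum>j<m. (if j = i then 1 else 0) * c j v) = c i v" for v
        using i by (simp add: if_distrib[of "\<lambda>x. x * _"] cong: if_cong)
      then have "\<forall>v\<in>unit_nbhd P e. \<bar>L (\<lambda>j. if j = i then 1 else 0) v - c i v\<bar> \<le> \<epsilon>"
        using near_comb[OF unit_mem_simplex_slice[OF i]] by simp
      moreover have "L (\<lambda>j. if j = i then 1 else 0) \<in> body"
        unfolding body_def by (intro imageI unit_mem_simplex_slice i)
      ultimately show ?thesis by (rule bexI)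
    qed
  qed (use body_nonempty fconvex_body body_pos in auto)
qed

end

section \<open>Hausdorff distances and convergence\<close>

lemma dH_nonneg: "F \<noteq> {} \<Longrightarrow> 0 \<le> dH A F G"
proof -
  assume "F \<noteq> {}"
  then obtain s where "s \<in> F" by blast
  then have "0 \<le> (SUP s\<in>F. INF t\<in>G. ereal \<bar>s A - t A\<bar>)"
    by (intro SUP_upper2[of s] INF_greatest) auto
  then show ?thesis by (simp add: dH_def le_max_iff_disj)
qed

lemma dH_le:
  assumes "\<And>s. s \<in> F \<Longrightarrow> \<exists>t\<in>G. \<bar>s A - t A\<bar> \<le> b"
    and "\<And>t. t \<in> G \<Longrightarrow> \<exists>s\<in>F. \<bar>s A - t A\<bar> \<le> b"
  shows "dH A F G \<le> ereal b"
  unfolding dH_def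
proof (intro max.boundedI SUP_least)
  show "(INF t\<in>G. ereal \<bar>s A - t A\<bar>) \<le> ereal b" if s: "s \<in> F" for s
    using assms(1)[OF s] by (meson INF_lower2 ereal_less_eq(3))
  show "(INF s\<in>F. ereal \<bar>s A - t A\<bar>) \<le> ereal b" if t: "t \<in> G" for t
    using assms(2)[OF t] by (meson INF_lower2 ereal_less_eq(3))
qed

theorem theorem4p14:
  fixes T :: "'a::real_vector topology" and P :: "'a set"
  assumes lc: "locally_convex_space T"
    and haus: "Hausdorff_space T"
    and sep: "separable_top T"
    and cone: "pos_convex_cone P"
    and intervals: "\<And>U. nbhd0 T U \<Longrightarrow>
        \<exists>A1 A2 V. nbhd0 T V \<and> V \<subseteq> ord_interval P A1 A2 \<and> ord_interval P A1 A2 \<subseteq> U"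
  shows "\<forall>U C. nbhd0 T U \<and> infdim_cond T U \<and> C \<in> CU_pos T P U \<longrightarrow>
           (\<exists>V Us. nbhd0 T V \<and> V \<subseteq> U \<and> (\<forall>n. Us n \<in> D0_pos T P V) \<and> wH_converges Us C)"
proof (intro allI impI)
  fix U C assume "nbhd0 T U \<and> infdim_cond T U \<and> C \<in> CU_pos T P U"
  then have U: "nbhd0 T U" "infdim_cond T U"
    and C: "C \<noteq> {}" "fconvex C" "C \<subseteq> polar T U" "C \<subseteq> dual_pos T P"
    by (auto simp: CU_pos_def CU_def)
  have tvs: "is_tvs T" using lc by (simp add: locally_convex_space_def)
  obtain e where "order_unit_tvs T P e" using interval_basis_order_unit[OF tvs cone intervals] by blast
  then interpret order_unit_tvs T P e .
  obtain S where "S \<subseteq> cdual T" "infinite S" "fun_lin_indep S" using U(2) by (auto simp: infdim_cond_def)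
  then have kernel: "\<exists>A. A \<noteq> 0 \<and> (\<forall>k<n. t k A = 0)" if "\<And>k. k < n \<Longrightarrow> linear (t k)"
    for t :: "nat \<Rightarrow> 'a \<Rightarrow> real" and n
    using that by (intro common_kernel_nontrivial[of n t S]) (auto simp: cdual_def)
  have pos_sep: "\<exists>f\<in>dual_pos T P. f A \<noteq> 0" if "A \<noteq> 0" for A
  proof -
    consider "gauge A \<noteq> 0" | "gauge (- A) \<noteq> 0" using gauge_definite[OF haus intervals] \<open>A \<noteq> 0\<close> by blast
    then show ?thesis
    proof cases
      case 1
      then show ?thesis using positive_functional_attaining_gauge[of A] by metis
    next
      case 2
      obtain f where f: "f \<in> dual_pos T P" "f (- A) = gauge (- A)"
        using positive_functional_attaining_gauge by blast
      then have "f A \<noteq> 0" using 2 by (simp add: linear_neg[OF dual_posD(1)[OF f(1)]])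
      then show ?thesis using f(1) by blast
    qed
  qed
  obtain D' where D': "countable D'" "T closure_of D' = topspace T" using sep by (auto simp: separable_top_def)
  have top: "topspace T = UNIV" using tvs by (simp add: is_tvs_def)
  then have "D' \<noteq> {}" using D'(2) by auto
  define d where "d = from_nat_into D'"
  have dense: "\<exists>k. d k - A \<in> V" if V: "nbhd0 T V" for V A
  proof -
    obtain V' where V': "openin T V'" "0 \<in> V'" "V' \<subseteq> V" using V by (auto simp: nbhd0_def)
    have "openin T {x. - A + 1 *\<^sub>R x \<in> V'}" by (rule openin_tvs_affine[OF tvs V'(1)])
    moreover have "A \<in> T closure_of D'" using D'(2) top by simp
    ultimately obtain x where "x \<in> D'" "- A + 1 *\<^sub>R x \<in> V'"
      using V'(2) unfolding in_closure_of by (metis (mono_tags, lifting) add.left_inverse mem_Collect_eq scaleR_one)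
    then show ?thesis using V'(3) from_nat_into_surj[OF D'(1), of x] unfolding d_def by auto
  qed
  have C_bd: "\<exists>b. \<forall>s\<in>C. \<bar>s A\<bar> \<le> b" for A
    using polar_pointwise_bounded[OF tvs U(1), of A] C(3) by (metis subsetD)
  \<comment> \<open>A functional within 1 of a member of \<open>C\<close> on
    \<open>unit_nbhd P e\<close> is at most 1 + 1 in absolute value at \<open>2 *\<^sub>R A\<close>,
    hence at most 1 at \<open>A\<close>. As \<open>\<epsilon> n \<le> 1\<close>, one
    \<open>V\<close> serves all approximants.\<close>
  define V where "V = U \<inter> {A. 2 *\<^sub>R A \<in> U \<inter> unit_nbhd P e}"
  have V: "nbhd0 T V" unfolding V_def by (intro nbhd0_Int nbhd0_scale tvs U(1) unit)
  define \<epsilon> where "\<epsilon> n = 1 / real (Suc n)" for n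
  have \<epsilon>: "0 < \<epsilon> n" "\<epsilon> n \<le> 1" for n by (auto simp: \<epsilon>_def)
  \<comment> \<open>A point t of \<open>C\<close> is matched through a net point r: t is near r only
    at the first n dense vectors, while s is near r on a whole neighborhood.\<close>
  have "\<exists>D. D \<in> D0_pos T P V
      \<and> (\<forall>s\<in>D. \<exists>t\<in>C. \<forall>v\<in>unit_nbhd P e. \<bar>s v - t v\<bar> \<le> \<epsilon> n)
      \<and> (\<forall>t\<in>C. \<exists>s\<in>D. \<exists>r\<in>C. (\<forall>v\<in>unit_nbhd P e. \<bar>s v - r v\<bar> \<le> \<epsilon> n) \<and> (\<forall>k<n. \<bar>t (d k) - r (d k)\<bar> \<le> \<epsilon> n))"
    for n
  proof -
    obtain F where F: "finite F" "F \<subseteq> C" "\<And>s. s \<in> C \<Longrightarrow> \<exists>t\<in>F. \<forall>k<n. \<bar>s (d k) - t (d k)\<bar> \<le> \<epsilon> n"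
      using finite_coordinate_net[OF \<epsilon>(1) C_bd] by metis
    have "F \<noteq> {}" using F(3) C(1) by blast
    obtain c :: "nat \<Rightarrow> 'a \<Rightarrow> real" where c: "F = c ` {..<card F}"
      using F(1) by (metis bij_betw_imp_surj_on ex_bij_betw_nat_finite lessThan_atLeast0)
    \<comment> \<open>The approximation lemma wants a sequence in \<open>C\<close> on all indices;
      \<open>c 0\<close> fills the places beyond the enumeration of \<open>F\<close>.\<close>
    define c' where "c' i = (if i < card F then c i else c 0)" for i
    have "0 < card F" using F(1) \<open>F \<noteq> {}\<close> by (simp add: card_gt_0_iff)
    then have "c' i \<in> C" for i using F(2) c by (auto simp: c'_def)
    then obtain D where D: "D \<noteq> {}" "fconvex D" "closedin (wstar T) D"
        "D = (wstar T) closure_of (exposed_points D)" "D \<subseteq> dual_pos T P"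
        "\<And>s. s \<in> D \<Longrightarrow> \<exists>t\<in>C. \<forall>v\<in>unit_nbhd P e. \<bar>s v - t v\<bar> \<le> \<epsilon> n"
        "\<And>i. i < card F \<Longrightarrow> \<exists>s\<in>D. \<forall>v\<in>unit_nbhd P e. \<bar>s v - c' i v\<bar> \<le> \<epsilon> n"
      using exists_approximant[OF kernel pos_sep C(2,4) _ \<open>0 < card F\<close> \<epsilon>(1)] by metis
    have "D \<subseteq> polar T V"
    proof
      fix s assume s: "s \<in> D"
      have "\<bar>s A\<bar> \<le> 1" if "A \<in> V" for A
      proof -
        obtain t where t: "t \<in> C" "\<forall>v\<in>unit_nbhd P e. \<bar>s v - t v\<bar> \<le> \<epsilon> n" using D(6)[OF s] by blast
        have "\<bar>s (2 *\<^sub>R A) - t (2 *\<^sub>R A)\<bar> \<le> 1" "\<bar>t (2 *\<^sub>R A)\<bar> \<le> 1"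
          using that t C(3) \<epsilon>(2)[of n] by (force simp: V_def polar_def)+
        then have "\<bar>s (2 *\<^sub>R A)\<bar> \<le> 2" by linarith
        moreover have "linear s" using D(5) s dual_posD(1) by blast
        ultimately show ?thesis by (simp add: linear_cmul)
      qed
      then show "s \<in> polar T V" using s D(5) by (auto simp: polar_def dual_pos_def)
    qed
    then have "D \<in> D0_pos T P V"
      using D(1-5) by (simp add: D0_pos_def D0_def CU_pos_def CU_def)
    moreover have "\<exists>s\<in>D. \<exists>r\<in>C. (\<forall>v\<in>unit_nbhd P e. \<bar>s v - r v\<bar> \<le> \<epsilon> n) \<and> (\<forall>k<n. \<bar>t (d k) - r (d k)\<bar> \<le> \<epsilon> n)"
      if "t \<in> C" for t
    proof -
      obtain r where r: "r \<in> F" "\<forall>k<n. \<bar>t (d k) - r (d k)\<bar> \<le> \<epsilon> n" using F(3)[OF \<open>t \<in> C\<close>] by blast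
      then obtain i where "i < card F" "r = c' i" using c by (auto simp: c'_def)
      then show ?thesis using D(7) r F(2) by blast
    qed
    ultimately show ?thesis using D(6) by blast
  qed
  then obtain Us where Us: "\<And>n. Us n \<in> D0_pos T P V"
      "\<And>n s. s \<in> Us n \<Longrightarrow> \<exists>t\<in>C. \<forall>v\<in>unit_nbhd P e. \<bar>s v - t v\<bar> \<le> \<epsilon> n"
      "\<And>n t. t \<in> C \<Longrightarrow> \<exists>s\<in>Us n. \<exists>r\<in>C. (\<forall>v\<in>unit_nbhd P e. \<bar>s v - r v\<bar> \<le> \<epsilon> n)
        \<and> (\<forall>k<n. \<bar>t (d k) - r (d k)\<bar> \<le> \<epsilon> n)"
    by metis
  have Us_dual: "Us n \<noteq> {}" "Us n \<subseteq> dual_pos T P" for n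
    using Us(1)[of n] by (auto simp: D0_pos_def CU_pos_def CU_def)
  have "(\<lambda>n. dH A (Us n) C) \<longlonglongrightarrow> 0" for A
  proof -
    obtain \<delta> where \<delta>: "0 < \<delta>" "\<And>c. \<bar>c\<bar> \<le> \<delta> \<Longrightarrow> c *\<^sub>R A \<in> unit_nbhd P e"
      using nbhd0_absorbing[OF tvs unit] by blast
    have near: "\<bar>s A - t A\<bar> \<le> \<epsilon> n / \<delta>"
      if "s \<in> dual_pos T P" "t \<in> C" "\<forall>v\<in>unit_nbhd P e. \<bar>s v - t v\<bar> \<le> \<epsilon> n" for s t n
    proof -
      have "linear s" "linear t" using that C(4) dual_posD(1) by blast+
      moreover have "\<bar>s (\<delta> *\<^sub>R A) - t (\<delta> *\<^sub>R A)\<bar> \<le> \<epsilon> n" using that(3) \<delta> by simp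
      ultimately have "\<delta> * \<bar>s A - t A\<bar> \<le> \<epsilon> n"
        using \<delta>(1) by (simp add: linear_cmul abs_mult flip: right_diff_distrib)
      then show ?thesis using \<delta>(1) by (simp add: field_simps)
    qed
    have \<epsilon>_lim: "\<epsilon> \<longlonglongrightarrow> 0" unfolding \<epsilon>_def using LIMSEQ_inverse_real_of_nat by (simp add: inverse_eq_divide)
    \<comment> \<open>Three errors of at most x: passing from \<open>A\<close> to \<open>d k\<close>
      for t, passing back for r, and the rounding at \<open>d k\<close> together with the distance
      between r and s at \<open>A\<close>.\<close>
    have ev: "\<forall>\<^sub>F n in sequentially. dH A (Us n) C \<le> ereal (3 * x)" if x: "0 < x" for x
    proof -
      \<comment> \<open>Members of \<open>C\<close> lie in the polar of \<open>U\<close>, so a dense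
        vector that differs from \<open>A\<close> by an element of x U changes their values by at
        most x.\<close>
      obtain k where k: "d k - A \<in> {v. (1 / x) *\<^sub>R v \<in> U}"
        using dense[OF nbhd0_scale[OF tvs U(1)]] by blast
      have dk: "\<bar>t (d k) - t A\<bar> \<le> x" if "t \<in> C" for t
      proof -
        have "\<bar>t ((1 / x) *\<^sub>R (d k - A))\<bar> \<le> 1" "linear t" using that C(3) k by (auto simp: polar_def cdual_def)
        then show ?thesis using x by (simp add: linear_cmul linear_diff abs_mult field_simps)
      qed
      have "(\<lambda>n. \<epsilon> n / \<delta> + \<epsilon> n) \<longlonglongrightarrow> 0 / \<delta> + 0" using \<delta>(1) by (intro tendsto_intros \<epsilon>_lim) simp
      then have "\<forall>\<^sub>F n in sequentially. \<epsilon> n / \<delta> + \<epsilon> n < x" using x by (auto dest: order_tendstoD(2))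
      then show ?thesis
        using eventually_gt_at_top[of k]
      proof eventually_elim
        case (elim n)
        have n: "\<epsilon> n / \<delta> \<le> x" "0 \<le> \<epsilon> n / \<delta>" using elim(1) \<epsilon>(1)[of n] \<delta>(1) by (auto simp: less_imp_le)
        show ?case
        proof (rule dH_le)
          show "\<exists>t\<in>C. \<bar>s A - t A\<bar> \<le> 3 * x" if "s \<in> Us n" for s
          proof -
            obtain t where t: "t \<in> C" "\<forall>v\<in>unit_nbhd P e. \<bar>s v - t v\<bar> \<le> \<epsilon> n" using Us(2) \<open>s \<in> Us n\<close> by blast
            then have "\<bar>s A - t A\<bar> \<le> \<epsilon> n / \<delta>" using near Us_dual \<open>s \<in> Us n\<close> by blast
            then show ?thesis using t(1) n x by force
          qed
          show "\<exists>s\<in>Us n. \<bar>s A - t A\<bar> \<le> 3 * x" if t: "t \<in> C" for t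
          proof -
            obtain s r where sr: "s \<in> Us n" "r \<in> C" "\<forall>v\<in>unit_nbhd P e. \<bar>s v - r v\<bar> \<le> \<epsilon> n"
              "\<forall>k<n. \<bar>t (d k) - r (d k)\<bar> \<le> \<epsilon> n" using Us(3)[OF t] by blast
            have "\<bar>s A - r A\<bar> \<le> \<epsilon> n / \<delta>" using near sr Us_dual by blast
            moreover have "\<bar>t (d k) - r (d k)\<bar> \<le> \<epsilon> n" using sr(4) elim(2) by blast
            ultimately have "\<bar>s A - t A\<bar> \<le> 3 * x" using dk[OF t] dk[OF sr(2)] elim(1) by linarith
            then show ?thesis using sr(1) by blast
          qed
        qed
      qed
    qed
    show ?thesis
    proof (rule order_tendstoI)
      show "\<forall>\<^sub>F n in sequentially. a < dH A (Us n) C" if "a < 0" for a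
        using dH_nonneg[OF Us_dual(1)] that by (intro always_eventually) (meson order_less_le_trans)
      show "\<forall>\<^sub>F n in sequentially. dH A (Us n) C < a" if "0 < a" for a
      proof -
        obtain y where y: "0 < ereal y" "ereal y < a" using ereal_dense2[OF \<open>0 < a\<close>] by blast
        then show ?thesis using ev[of "y / 3"] by (auto elim!: eventually_mono)
      qed
    qed
  qed
  then have "wH_converges Us C" by (simp add: wH_converges_def)
  moreover have "V \<subseteq> U" by (auto simp: V_def)
  ultimately show "\<exists>V Us. nbhd0 T V \<and> V \<subseteq> U \<and> (\<forall>n. Us n \<in> D0_pos T P V) \<and> wH_converges Us C"
    using V Us(1) by blast
qed

end
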